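(* Let $n$ be a positive integer, let $1\le k\le n$, and let $1\le i_1<i_2<\cdots<i_k\le n$ be integers. Let $A,B$ be $n\times n$ complex strictly contractive matrices. Put $$F=I-B^*B,\qquad H=(A-B)^*(I-AA^* )^{-1}(A-B).$$ Then $$\prod_{t=1}^k\sigma^2_{i_t}(I-A^*B)\ \ge\ \prod_{t=1}^k\big[1-\lambda_t(A^*A)\big]\big[1-\lambda_{n-i_t+1}(B^*B)\big]+\prod_{t=1}^k\frac{\big[1-\lambda_t(A^*A)\big]\,\sigma^2_{n-t+1}(A-B)}{1-\lambda_{n-t+1}(A^*A)}$$ $$\qquad\qquad+\ (2^k-2)\prod_{t=1}^k\big[1-\lambda_t(A^*A)\big]\big[\lambda_{i_t}(F)\,\lambda_{n-t+1}(H)\big]^{\frac12}.$$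
   Context: $X^*$ is the conjugate transpose of $X$, and $I$ is the $n\times n$ identity matrix. A matrix $A\in\mathbb{C}^{n\times n}$ is strictly contractive if $I-A^*A$ is positive definite, equivalently its largest singular value is $<1$. For an $n\times n$ matrix $X$ with all eigenvalues real, $\lambda_1(X)\ge\cdots\ge\lambda_n(X)$ denote its eigenvalues in decreasing order (with multiplicity). For any $n\times n$ complex matrix $X$, $\sigma_1(X)\ge\cdots\ge\sigma_n(X)$ denote its singular values in decreasing order, and $\sigma_j^2(X)=(\sigma_j(X))^2$. *)

theory Defs
  imports
    "HOL-Computational_Algebra.Fundamental_Theorem_Algebra"
    "Jordan_Normal_Form.Schur_Decomposition"
    "Jordan_Normal_Form.Gauss_Jordan_Elimination"
begin

text \<open>The conjugate transpose is \<^const>\<open>mat_adjoint\<close>.\<close>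

abbreviation adj :: "complex mat \<Rightarrow> complex mat" where
  "adj X \<equiv> mat_adjoint X"

lemma adj_carrier: "X \<in> carrier_mat m n \<Longrightarrow> adj X \<in> carrier_mat n m"
  by (auto simp: mat_adjoint_def mat_of_rows_def)

lemma adj_index:
  assumes "X \<in> carrier_mat m n" "r < n" "c < m"
  shows "adj X $$ (r, c) = cnj (X $$ (c, r))"
  using assms by (auto simp: mat_adjoint_def mat_of_rows_def)

text \<open>\<open>v \<bullet>c w\<close> conjugates its second argument, so \<open>(M *\<^sub>v v) \<bullet>c v\<close> is
  \<open>v\<^sup>* M v\<close>; it is real for Hermitian \<open>M\<close>.\<close>

definition pos_def :: "complex mat \<Rightarrow> bool" where
  "pos_def M \<longleftrightarrow> square_mat M \<and> adj M = M \<and>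
     (\<forall>v \<in> carrier_vec (dim_row M). v \<noteq> 0\<^sub>v (dim_row M) \<longrightarrow> 0 < Re ((M *\<^sub>v v) \<bullet>c v))"

definition strictly_contractive :: "complex mat \<Rightarrow> bool" where
  "strictly_contractive X \<longleftrightarrow>
     square_mat X \<and> pos_def (1\<^sub>m (dim_row X) - adj X * X)"

text \<open>The eigenvalues of a matrix all of whose eigenvalues are real, in decreasing order and
  repeated according to algebraic multiplicity.  Taking real parts only changes the type; on a
  matrix with a non-real eigenvalue the list has no intended meaning.\<close>

definition real_eigvals :: "complex mat \<Rightarrow> real list" where
  "real_eigvals X = rev (sorted_list_of_multiset (image_mset Re (proots (char_poly X))))"

lemma length_real_eigvals:
  assumes "X \<in> carrier_mat n n"
  shows "length (real_eigvals X) = n"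
proof -
  have "length (real_eigvals X)
      = size (mset (sorted_list_of_multiset (image_mset Re (proots (char_poly X)))))"
    unfolding real_eigvals_def by (simp only: length_rev size_mset)
  also have "\<dots> = degree (char_poly X)"
    by (simp only: mset_sorted_list_of_multiset size_image_mset size_proots_complex)
  finally show ?thesis
    using degree_monic_char_poly[OF assms] by simp
qed

text \<open>As in the usual notation, the index is 1-based; it is meaningful for \<open>1 \<le> j \<le> n\<close>.\<close>

definition eigval :: "nat \<Rightarrow> complex mat \<Rightarrow> real" where
  "eigval j X = real_eigvals X ! (j - 1)"

definition singval :: "nat \<Rightarrow> complex mat \<Rightarrow> real" where
  "singval j X = sqrt (eigval j (adj X * X))"

text \<open>\<^const>\<open>mat_inverse\<close> returns \<open>Some\<close> of the two-sided inverse if there is one, and \<open>None\<close>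
  otherwise.\<close>

definition inv_mat :: "complex mat \<Rightarrow> complex mat" where
  "inv_mat X = the (mat_inverse X)"

end

theory Submission
  imports Defs
begin

text \<open>Put \<open>C = I - A\<^sup>*B\<close>, \<open>G = (I - A\<^sup>*A)\<^sup>-\<^sup>1\<close> and \<open>K = (I - AA\<^sup>*)\<^sup>-\<^sup>1\<close>. Hua's identity
  reads \<open>C\<^sup>*GC = F + H\<close> with \<open>H = (A - B)\<^sup>*K(A - B)\<close>.

  For indices \<open>i\<^sub>1 < \<dots> < i\<^sub>k\<close> there is an isometry \<open>V\<close> with \<open>k\<close> columns such that, for all \<open>t\<close>, the
  \<open>t\<close>-th eigenvalue of \<open>V\<^sup>*C\<^sup>*CV\<close> is at most the \<open>i\<^sub>t\<close>-th eigenvalue of \<open>C\<^sup>*C\<close>, while the \<open>t\<close>-th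
  eigenvalue of \<open>V\<^sup>*FV\<close> is at least the \<open>i\<^sub>t\<close>-th eigenvalue of \<open>F\<close>. It is obtained by induction on the
  dimension: while some \<open>j\<close> is not among the indices, compress to a hyperplane containing the
  \<open>j - 1\<close> leading eigenvectors of \<open>F\<close> and the \<open>n - j\<close> trailing ones of \<open>C\<^sup>*C\<close>.

  Factoring \<open>CV = QR\<close> with an isometry \<open>Q\<close> bounds \<open>det (V\<^sup>*C\<^sup>*GCV)\<close> by \<open>det (V\<^sup>*C\<^sup>*CV)\<close> times the \<open>k\<close>
  largest eigenvalues of \<open>G\<close>, so the left-hand side is at least
  \<open>\<Prod>\<^sub>t (1 - \<lambda>\<^sub>t(A\<^sup>*A)) \<sqdot> det (V\<^sup>*FV + V\<^sup>*HV)\<close>. Finally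
  \<open>det (P + Q) \<ge> det P + det Q + (2\<^sup>k - 2) (det P det Q)\<^sup>1\<^sup>/\<^sup>2\<close> for \<open>P > 0\<close>, \<open>Q \<ge> 0\<close>, and
  \<open>det (V\<^sup>*HV)\<close> is bounded below by the product of the \<open>k\<close> smallest eigenvalues of \<open>H\<close>, and also
  by that of \<open>(A - B)\<^sup>*(A - B)\<close> times that of \<open>K\<close>.\<close>

section \<open>Adjoints and orthonormal eigenbases\<close>

lemma adj_dim [simp]: "dim_row (adj X) = dim_col X" "dim_col (adj X) = dim_row X"
  by (simp_all add: mat_adjoint_def)

lemma adj_nth [simp]: "r < dim_col X \<Longrightarrow> c < dim_row X \<Longrightarrow> adj X $$ (r, c) = cnj (X $$ (c, r))"
  by (rule adj_index) auto

lemma adj_adj [simp]: "adj (adj X) = X"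
  by (rule eq_matI) auto

lemma adj_one [simp]: "adj (1\<^sub>m n) = 1\<^sub>m n"
  by (rule eq_matI) auto

lemma adj_add: "dim_row X = dim_row Y \<Longrightarrow> dim_col X = dim_col Y \<Longrightarrow> adj (X + Y) = adj X + adj Y"
  by (rule eq_matI) auto

lemma adj_minus: "dim_row X = dim_row Y \<Longrightarrow> dim_col X = dim_col Y \<Longrightarrow> adj (X - Y) = adj X - adj Y"
  by (rule eq_matI) auto

lemma adj_mult: "dim_col X = dim_row Y \<Longrightarrow> adj (X * Y) = adj Y * adj X"
  by (rule eq_matI) (auto simp: scalar_prod_def mult.commute intro!: sum.cong)

lemma det_adj:
  assumes "X \<in> carrier_mat n n"
  shows "det (adj X) = cnj (det X)"
proof -
  have "adj X = map_mat cnj (transpose_mat X)"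
    using assms by (intro eq_matI) auto
  then have "det (adj X) = det (map_mat cnj (transpose_mat X))" by simp
  also have "\<dots> = cnj (det (transpose_mat X))"
  proof -
    interpret comm_ring_hom cnj by unfold_locales auto
    show ?thesis by (rule hom_det)
  qed
  finally show ?thesis using det_transpose[OF assms] by simp
qed

lemma mult_assoc_dim:
  fixes A B C :: "'a :: semiring_0 mat"
  shows "dim_col A = dim_row B \<Longrightarrow> dim_col B = dim_row C \<Longrightarrow> A * B * C = A * (B * C)"
  by (rule assoc_mult_mat) auto

lemma mult_mat_vec_assoc_dim:
  fixes A B :: "'a :: semiring_0 mat"
  shows "dim_col A = dim_row B \<Longrightarrow> dim_vec v = dim_col B \<Longrightarrow> A * B *\<^sub>v v = A *\<^sub>v (B *\<^sub>v v)"
  by (rule assoc_mult_mat_vec[OF carrier_matI carrier_matI carrier_vecI]) simp_all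

section \<open>The Hermitian inner product and isometries\<close>

lemma cscalar_prod_sum: "v \<bullet>c w = (\<Sum>i<dim_vec w. v $ i * cnj (w $ i))"
  by (auto simp: scalar_prod_def atLeast0LessThan conjugate_vec_def)

lemma cscalar_prod_self: "v \<bullet>c v = complex_of_real (\<Sum>i<dim_vec v. (cmod (v $ i))\<^sup>2)"
  unfolding cscalar_prod_sum by (simp add: complex_norm_square del: of_real_power)

lemma cscalar_prod_adj:
  assumes "dim_vec v = dim_col A" "dim_vec w = dim_row A"
  shows "(A *\<^sub>v v) \<bullet>c w = v \<bullet>c (adj A *\<^sub>v w)"
proof -
  have "(A *\<^sub>v v) \<bullet>c w = (\<Sum>i<dim_row A. \<Sum>j<dim_col A. A $$ (i,j) * v $ j * cnj (w $ i))"
    using assms unfolding cscalar_prod_sum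
    by (auto simp: scalar_prod_def sum_distrib_right atLeast0LessThan intro!: sum.cong)
  also have "\<dots> = (\<Sum>j<dim_col A. \<Sum>i<dim_row A. A $$ (i,j) * v $ j * cnj (w $ i))"
    by (rule sum.swap)
  also have "\<dots> = v \<bullet>c (adj A *\<^sub>v w)"
    using assms unfolding cscalar_prod_sum
    by (auto simp: scalar_prod_def sum_distrib_left atLeast0LessThan intro!: sum.cong)
  finally show ?thesis .
qed

lemma cscalar_prod_isometry:
  assumes "V \<in> carrier_mat n k" "adj V * V = 1\<^sub>m k" "v \<in> carrier_vec k"
  shows "(V *\<^sub>v v) \<bullet>c (V *\<^sub>v v) = v \<bullet>c v"
proof -
  have "adj V *\<^sub>v (V *\<^sub>v v) = v"
    using assms mult_mat_vec_assoc_dim[of "adj V" V v] by simp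
  then show ?thesis using assms by (simp add: cscalar_prod_adj)
qed

lemma cscalar_prod_self_pos:
  "v \<in> carrier_vec n \<Longrightarrow> v \<noteq> 0\<^sub>v n \<Longrightarrow> 0 < Re (v \<bullet>c v)"
proof -
  assume v: "v \<in> carrier_vec n" "v \<noteq> 0\<^sub>v n"
  have "v \<bullet>c v \<noteq> 0" using conjugate_square_eq_0_vec[OF v(1)] v(2) by simp
  then have "(\<Sum>i<dim_vec v. (cmod (v $ i))\<^sup>2) \<noteq> 0"
    unfolding cscalar_prod_self by (metis of_real_0)
  moreover have "(\<Sum>i<dim_vec v. (cmod (v $ i))\<^sup>2) \<ge> 0" by (rule sum_nonneg) simp
  ultimately show ?thesis unfolding cscalar_prod_self by (simp only: Re_complex_of_real)
qed

section \<open>Unitary diagonalization and orthonormal bases\<close>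

lemma mat_diag_dims [simp]: "dim_row (mat_diag n f) = n" "dim_col (mat_diag n f) = n"
  by (simp_all add: mat_diag_def)

text \<open>No order is imposed on \<open>d\<close>: \<open>I - X\<close> and its inverse are
  diagonalized by the eigenvectors of \<open>X\<close>, and sorting is a separate step. Only the
  values of \<open>d\<close> below \<open>n\<close> matter.\<close>

definition eigen_decomp :: "nat \<Rightarrow> complex mat \<Rightarrow> (nat \<Rightarrow> real) \<Rightarrow> complex mat \<Rightarrow> bool" where
  "eigen_decomp n U d X \<longleftrightarrow> U \<in> carrier_mat n n \<and> adj U * U = 1\<^sub>m n \<and> U * adj U = 1\<^sub>m n
     \<and> X = U * mat_diag n (\<lambda>i. complex_of_real (d i)) * adj U"

text \<open>Eigenvectors as columns give \<open>X * U = U * D\<close>. As \<open>U\<close> is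
  square, \<open>adj U * U = I\<close> implies \<open>U * adj U = I\<close>, so multiplying by
  \<open>adj U\<close> on the right isolates \<open>X\<close>.\<close>

lemma eigen_decompI:
  assumes X: "X \<in> carrier_mat n n" and U: "U \<in> carrier_mat n n" and UU: "adj U * U = 1\<^sub>m n"
    and ev: "\<And>j. j < n \<Longrightarrow> X *\<^sub>v col U j = complex_of_real (d j) \<cdot>\<^sub>v col U j"
  shows "eigen_decomp n U d X"
proof -
  let ?D = "mat_diag n (\<lambda>i. complex_of_real (d i))"
  have UU': "U * adj U = 1\<^sub>m n"
    by (rule mat_mult_left_right_inverse[OF adj_carrier[OF U] U UU])
  have "X * U = U * ?D"
  proof (rule eq_matI)
    fix i j assume "i < dim_row (U * ?D)" "j < dim_col (U * ?D)"
    then have ij: "i < n" "j < n" using U by (auto simp: mat_diag_def)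
    have "(X * U) $$ (i,j) = (X *\<^sub>v col U j) $ i" using X U ij by simp
    also have "\<dots> = complex_of_real (d j) * U $$ (i,j)" using ev ij U by simp
    also have "\<dots> = (U * ?D) $$ (i,j)" using U ij by (simp add: mat_diag_mult_right)
    finally show "(X * U) $$ (i,j) = (U * ?D) $$ (i,j)" .
  qed (use X U in \<open>auto simp: mat_diag_def\<close>)
  then have "X * U * adj U = U * ?D * adj U" by simp
  moreover have "X * U * adj U = X"
    using X U UU' by (simp add: mult_assoc_dim)
  ultimately show ?thesis using U UU UU' unfolding eigen_decomp_def by simp
qed

lemma eigen_decompD:
  assumes "eigen_decomp n U d X"
  shows "U \<in> carrier_mat n n" "adj U * U = 1\<^sub>m n" "U * adj U = 1\<^sub>m n"
    "X = U * mat_diag n (\<lambda>i. complex_of_real (d i)) * adj U" "X \<in> carrier_mat n n"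
proof -
  show U: "U \<in> carrier_mat n n" and "adj U * U = 1\<^sub>m n" "U * adj U = 1\<^sub>m n"
    and X: "X = U * mat_diag n (\<lambda>i. complex_of_real (d i)) * adj U"
    using assms unfolding eigen_decomp_def by blast+
  show "X \<in> carrier_mat n n"
    unfolding X using U by (intro carrier_matI) auto
qed

lemma eigen_decomp_col:
  assumes "eigen_decomp n U d X" "j < n"
  shows "X *\<^sub>v col U j = complex_of_real (d j) \<cdot>\<^sub>v col U j"
proof -
  note D = eigen_decompD[OF assms(1)]
  let ?D = "mat_diag n (\<lambda>i. complex_of_real (d i))"
  have "X * U = U * ?D * (adj U * U)"
    unfolding D(4) using D(1) by (simp add: mult_assoc_dim)
  also have "\<dots> = U * ?D" using D(1) by (simp add: D(2))
  finally have *: "X * U = U * ?D" .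
  show ?thesis
  proof (rule eq_vecI)
    fix i assume "i < dim_vec (complex_of_real (d j) \<cdot>\<^sub>v col U j)"
    then have i: "i < n" using D(1) by simp
    have "(X *\<^sub>v col U j) $ i = (X * U) $$ (i,j)" using D(1,5) i assms(2) by simp
    also have "\<dots> = complex_of_real (d j) * U $$ (i,j)"
      unfolding * using D(1) i assms(2) by (simp add: mat_diag_mult_right)
    finally show "(X *\<^sub>v col U j) $ i = (complex_of_real (d j) \<cdot>\<^sub>v col U j) $ i"
      using D(1) i assms(2) by simp
  qed (use D(1,5) in auto)
qed

text \<open>In the coordinates \<open>adj U *\<^sub>v w\<close> the form is diagonal, so a Rayleigh
  quotient becomes a weighted average of the \<open>d j\<close>.\<close>

lemma eigen_decomp_form:
  assumes "eigen_decomp n U d X" "w \<in> carrier_vec n"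
  shows "(X *\<^sub>v w) \<bullet>c w = complex_of_real (\<Sum>j<n. d j * (cmod ((adj U *\<^sub>v w) $ j))\<^sup>2)"
    and "w \<bullet>c w = complex_of_real (\<Sum>j<n. (cmod ((adj U *\<^sub>v w) $ j))\<^sup>2)"
proof -
  note D = eigen_decompD[OF assms(1)]
  let ?D = "mat_diag n (\<lambda>i. complex_of_real (d i))"
  define a where "a = adj U *\<^sub>v w"
  have a: "a \<in> carrier_vec n" using D(1) by (intro carrier_vecI) (simp add: a_def)
  have "X *\<^sub>v w = U *\<^sub>v (?D *\<^sub>v a)"
    using D(1) assms(2) by (subst D(4)) (simp add: mult_mat_vec_assoc_dim a_def)
  then have "(X *\<^sub>v w) \<bullet>c w = (?D *\<^sub>v a) \<bullet>c a"
    using D(1) assms(2) by (simp add: cscalar_prod_adj a_def)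
  also have "?D *\<^sub>v a = vec n (\<lambda>j. complex_of_real (d j) * a $ j)"
    using a by (intro eq_vecI) (auto simp: mat_diag_def scalar_prod_def if_distrib[where f = "\<lambda>x. x * _"] cong: if_cong)
  also have "\<dots> \<bullet>c a = complex_of_real (\<Sum>j<n. d j * (cmod (a $ j))\<^sup>2)"
    using a by (auto simp: cscalar_prod_sum complex_norm_square mult.assoc simp del: of_real_power intro!: sum.cong)
  finally show "(X *\<^sub>v w) \<bullet>c w = complex_of_real (\<Sum>j<n. d j * (cmod ((adj U *\<^sub>v w) $ j))\<^sup>2)"
    unfolding a_def .
  have "w \<bullet>c w = a \<bullet>c a"
    using cscalar_prod_isometry[of "adj U" n n w] D(1,3) assms(2) adj_carrier[OF D(1)] by (simp only: a_def adj_adj)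
  also have "\<dots> = complex_of_real (\<Sum>j<n. (cmod (a $ j))\<^sup>2)"
    using a by (simp add: cscalar_prod_self)
  finally show "w \<bullet>c w = complex_of_real (\<Sum>j<n. (cmod ((adj U *\<^sub>v w) $ j))\<^sup>2)" 
    unfolding a_def .
qed

text \<open>Gram-Schmidt applied to a basis that starts with \<open>z\<close> leaves
  \<open>z\<close> in first place and yields orthogonal vectors, which are then normalized;
  \<open>c\<close> is the reciprocal of the norm of \<open>z\<close>.\<close>

lemma orthonormal_completion:
  fixes z :: "complex vec"
  assumes z: "z \<in> carrier_vec n" "z \<noteq> 0\<^sub>v n"
  obtains U c where "U \<in> carrier_mat n n" "adj U * U = 1\<^sub>m n" "c \<noteq> 0" "col U 0 = c \<cdot>\<^sub>v z"
proof -
  interpret cof_vec_space n "TYPE(complex)" .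
  have n: "n \<noteq> 0" using z by (metis vec_of_dim_0 carrier_vecD)
  define b where "b = basis_completion z"
  define ws where "ws = gram_schmidt n b"
  from basis_completion[OF z, folded b_def]
  have dist_b: "distinct b" and indep: "\<not> lin_dep (set b)" and b: "set b \<subseteq> carrier_vec n"
    and hdb: "hd b = z" and len_b: "length b = n" by auto
  from hdb len_b n obtain vs where bv: "b = z # vs" by (cases b) auto
  from gram_schmidt_result[OF b dist_b indep refl, folded ws_def]
  have ws: "set ws \<subseteq> carrier_vec n" "corthogonal ws" "length ws = n"
    by (auto simp: len_b)
  have hdws: "ws ! 0 = z"
    using gram_schmidt_hd[OF z(1), of vs, folded bv] ws(3) n unfolding ws_def
    by (metis hd_conv_nth length_0_conv)
  define r where "r j = sqrt (Re (ws ! j \<bullet>c ws ! j))" for j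
  define U where "U = mat n n (\<lambda>(i,j). ws ! j $ i / complex_of_real (r j))"
  have wc: "ws ! j \<in> carrier_vec n" if "j < n" for j using ws that by auto
  have rpos: "r j > 0" if "j < n" for j
  proof -
    have "ws ! j \<bullet>c ws ! j \<noteq> 0" using corthogonalD[OF ws(2)] ws(3) that by blast
    then have "ws ! j \<noteq> 0\<^sub>v n" using wc[OF that] by auto
    from cscalar_prod_self_pos[OF wc[OF that] this] show ?thesis by (simp add: r_def)
  qed
  have U: "U \<in> carrier_mat n n" by (simp add: U_def)
  have "adj U * U = 1\<^sub>m n"
  proof (rule eq_matI)
    fix i j assume "i < dim_row (1\<^sub>m n :: complex mat)" "j < dim_col (1\<^sub>m n :: complex mat)"
    then have ij: "i < n" "j < n" by auto
    have "(adj U * U) $$ (i,j) = (\<Sum>l<n. cnj (U $$ (l,i)) * U $$ (l,j))"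
      using U ij by (auto simp: scalar_prod_def atLeast0LessThan intro!: sum.cong)
    also have "\<dots> = (\<Sum>l<n. ws ! j $ l * cnj (ws ! i $ l)) / (complex_of_real (r i) * complex_of_real (r j))"
      using ij by (auto simp: U_def sum_divide_distrib intro!: sum.cong)
    also have "(\<Sum>l<n. ws ! j $ l * cnj (ws ! i $ l)) = ws ! j \<bullet>c ws ! i"
      using carrier_vecD[OF wc[OF ij(1)]] by (simp only: cscalar_prod_sum)
    also have "ws ! j \<bullet>c ws ! i / (complex_of_real (r i) * complex_of_real (r j)) = (if i = j then 1 else 0)"
    proof (cases "i = j")
      case True
      have nn: "(\<Sum>i<dim_vec (ws ! j). (cmod (ws ! j $ i))\<^sup>2) \<ge> 0" by (rule sum_nonneg) simp
      have "r j * r j = (\<Sum>i<dim_vec (ws ! j). (cmod (ws ! j $ i))\<^sup>2)"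
        using nn unfolding r_def cscalar_prod_self by (simp only: Re_complex_of_real real_sqrt_mult_self abs_of_nonneg)
      then have "ws ! j \<bullet>c ws ! j = complex_of_real (r j * r j)"
        unfolding cscalar_prod_self by (simp only:)
      with True rpos[OF ij(2)] show ?thesis by simp
    next
      case False
      then show ?thesis using corthogonalD[OF ws(2), of j i] ws(3) ij by auto
    qed
    finally show "(adj U * U) $$ (i,j) = 1\<^sub>m n $$ (i,j)" using ij by simp
  qed (use U in auto)
  moreover have "col U 0 = complex_of_real (1 / r 0) \<cdot>\<^sub>v z"
    using n z hdws by (intro eq_vecI) (auto simp: U_def)
  ultimately show ?thesis using that[OF U, of "complex_of_real (1 / r 0)"] rpos[of 0] n by simp
qed

text \<open>Deleting the first column of a unitary matrix whose first column is a multiple of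
  \<open>z\<close> leaves an orthonormal basis of the hyperplane orthogonal to \<open>z\<close>.
  Hence \<open>V * adj V\<close> is the projection onto it and fixes its vectors.\<close>

lemma orthogonal_complement:
  fixes z :: "complex vec"
  assumes z: "z \<in> carrier_vec (Suc m)" "z \<noteq> 0\<^sub>v (Suc m)"
  obtains V where "V \<in> carrier_mat (Suc m) m" "adj V * V = 1\<^sub>m m" "adj V *\<^sub>v z = 0\<^sub>v m"
    "\<And>x. x \<in> carrier_vec (Suc m) \<Longrightarrow> x \<bullet>c z = 0 \<Longrightarrow> V *\<^sub>v (adj V *\<^sub>v x) = x"
proof -
  let ?n = "Suc m"
  obtain U c where U: "U \<in> carrier_mat ?n ?n" and UU: "adj U * U = 1\<^sub>m ?n" and c: "c \<noteq> 0"
    and col0: "col U 0 = c \<cdot>\<^sub>v z"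
    using orthonormal_completion[OF z] by blast
  have UU': "U * adj U = 1\<^sub>m ?n"
    by (rule mat_mult_left_right_inverse[OF adj_carrier[OF U] U UU])
  have U0: "U $$ (l,0) = c * z $ l" if "l < ?n" for l
  proof -
    have "U $$ (l,0) = col U 0 $ l" using U that by simp
    then show ?thesis using z that by (simp add: col0)
  qed
  define V where "V = mat ?n m (\<lambda>(i,j). U $$ (i, Suc j))"
  have V: "V \<in> carrier_mat ?n m" by (simp add: V_def)
  have entry: "(\<Sum>l<?n. cnj (U $$ (l,i)) * U $$ (l,j)) = (if i = j then 1 else 0)"
    if "i < ?n" "j < ?n" for i j
  proof -
    have "(adj U * U) $$ (i,j) = (\<Sum>l<?n. cnj (U $$ (l,i)) * U $$ (l,j))"
      using U that by (auto simp: scalar_prod_def atLeast0LessThan simp del: sum.lessThan_Suc intro!: sum.cong)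
    then show ?thesis using that by (simp add: UU)
  qed
  have "adj V * V = 1\<^sub>m m"
  proof (rule eq_matI)
    fix i j assume "i < dim_row (1\<^sub>m m :: complex mat)" "j < dim_col (1\<^sub>m m :: complex mat)"
    then have ij: "i < m" "j < m" by auto
    have "(adj V * V) $$ (i,j) = (\<Sum>l<?n. cnj (U $$ (l,Suc i)) * U $$ (l,Suc j))"
      using ij by (auto simp: V_def scalar_prod_def atLeast0LessThan simp del: sum.lessThan_Suc intro!: sum.cong)
    then show "(adj V * V) $$ (i,j) = 1\<^sub>m m $$ (i,j)" using ij entry[of "Suc i" "Suc j"] by simp
  qed (use V in auto)
  moreover have "adj V *\<^sub>v z = 0\<^sub>v m"
  proof (rule eq_vecI)
    fix i assume "i < dim_vec (0\<^sub>v m :: complex vec)"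
    then have i: "i < m" by simp
    have "c * (adj V *\<^sub>v z) $ i = (\<Sum>l<?n. cnj (U $$ (l,Suc i)) * (c * z $ l))"
      using i z V by (auto simp: V_def scalar_prod_def atLeast0LessThan sum_distrib_left
          simp del: sum.lessThan_Suc intro!: sum.cong)
    also have "\<dots> = (\<Sum>l<?n. cnj (U $$ (l,Suc i)) * U $$ (l,0))"
      using U0 by (intro sum.cong) auto
    also have "\<dots> = 0" using entry[of "Suc i" 0] i by simp
    finally show "(adj V *\<^sub>v z) $ i = 0\<^sub>v m $ i" using c i by simp
  qed (use V in auto)
  moreover have "V *\<^sub>v (adj V *\<^sub>v x) = x" if x: "x \<in> carrier_vec ?n" and xz: "x \<bullet>c z = 0" for x
  proof -
    define a where "a = adj U *\<^sub>v x"
    have a: "a \<in> carrier_vec ?n" unfolding a_def using U by (intro carrier_vecI) auto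
    have Ua: "U *\<^sub>v a = x"
      unfolding a_def using U x UU' mult_mat_vec_assoc_dim[of U "adj U" x] by simp
    \<comment> \<open>Coordinate 0 of \<open>x\<close> in the basis \<open>U\<close> is a multiple
      of the inner product with \<open>z\<close>, so it vanishes and the remaining columns, those of
      \<open>V\<close>, already reproduce \<open>x\<close>.\<close>
    have "a $ 0 = (\<Sum>l<?n. cnj (c * z $ l) * x $ l)"
      unfolding a_def using U x U0
      by (auto simp: scalar_prod_def atLeast0LessThan simp del: sum.lessThan_Suc intro!: sum.cong)
    also have "\<dots> = cnj c * (x \<bullet>c z)"
      using z x by (auto simp: cscalar_prod_sum sum_distrib_left mult_ac simp del: sum.lessThan_Suc intro!: sum.cong)
    finally have a0: "a $ 0 = 0" using xz by simp
    have av: "(adj V *\<^sub>v x) $ j = a $ Suc j" if "j < m" for j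
      unfolding a_def using U x that
      by (auto simp: V_def scalar_prod_def atLeast0LessThan simp del: sum.lessThan_Suc intro!: sum.cong)
    have "V *\<^sub>v (adj V *\<^sub>v x) = U *\<^sub>v a"
    proof (rule eq_vecI)
      fix i assume "i < dim_vec (U *\<^sub>v a)"
      then have i: "i < ?n" using U by simp
      define y where "y = adj V *\<^sub>v x"
      have y: "dim_vec y = m" "\<And>j. j < m \<Longrightarrow> y $ j = a $ Suc j"
        using V av by (auto simp: y_def simp del: index_mult_mat_vec)
      have "(V *\<^sub>v y) $ i = (\<Sum>j<m. U $$ (i, Suc j) * a $ Suc j)"
        using i y by (auto simp: V_def scalar_prod_def atLeast0LessThan)
      then have "(V *\<^sub>v (adj V *\<^sub>v x)) $ i = (\<Sum>j<m. U $$ (i, Suc j) * a $ Suc j)"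
        by (simp only: y_def)
      also have "\<dots> = (\<Sum>j<?n. U $$ (i,j) * a $ j)"
        unfolding sum.lessThan_Suc_shift using a0 by simp
      also have "\<dots> = (U *\<^sub>v a) $ i"
        using U a i by (auto simp: scalar_prod_def atLeast0LessThan simp del: sum.lessThan_Suc)
      finally show "(V *\<^sub>v (adj V *\<^sub>v x)) $ i = (U *\<^sub>v a) $ i" .
    qed (use U V in auto)
    then show ?thesis using Ua by simp
  qed
  ultimately show ?thesis using that[OF V] by blast
qed

section \<open>The spectral theorem\<close>

lemma index_adj_mult:
  assumes "A \<in> carrier_mat n m" "B \<in> carrier_mat n k" "i < m" "j < k"
  shows "(adj A * B) $$ (i,j) = col B j \<bullet>c col A i"
  using assms by (auto simp: scalar_prod_def mult.commute intro!: sum.cong)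

lemma hermitian_eigenvalue_real:
  assumes X: "X \<in> carrier_mat n n" "adj X = X"
    and v: "v \<in> carrier_vec n" "v \<noteq> 0\<^sub>v n" and ev: "X *\<^sub>v v = e \<cdot>\<^sub>v v"
  shows "e = complex_of_real (Re e)"
proof -
  have vv: "v \<bullet>c v \<noteq> 0" using cscalar_prod_self_pos[OF v] by auto
  have "(X *\<^sub>v v) \<bullet>c v = v \<bullet>c (X *\<^sub>v v)"
    using cscalar_prod_adj[of v X v] X v by simp
  then have "e * (v \<bullet>c v) = cnj e * (v \<bullet>c v)"
    unfolding ev using v by (simp add: conjugate_smult_vec)
  with vv have "e = cnj e" by simp
  then show ?thesis by (simp add: complex_eq_iff)
qed

text \<open>Deflation: split off a unit eigenvector \<open>u\<close>, which exists by the
  fundamental theorem of algebra, and diagonalize the compression of \<open>X\<close> to the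
  orthogonal complement of \<open>u\<close>.\<close>

lemma hermitian_eigen_decomp:
  assumes "X \<in> carrier_mat n n" "adj X = X"
  shows "\<exists>U d. eigen_decomp n U d X"
  using assms
proof (induction n arbitrary: X)
  case 0
  have "X = 1\<^sub>m 0 * mat_diag 0 (\<lambda>i. complex_of_real 0) * adj (1\<^sub>m 0)"
    using 0 by (intro eq_matI) auto
  then have "eigen_decomp 0 (1\<^sub>m 0) (\<lambda>_. 0) X"
    unfolding eigen_decomp_def by auto
  then show ?case by blast
next
  case (Suc m)
  let ?n = "Suc m"
  note X = Suc.prems(1) and herm = Suc.prems(2)
  have "degree (char_poly X) = ?n" using degree_monic_char_poly[OF X] by simp
  then have "\<not> constant (poly (char_poly X))" by (simp add: constant_degree)
  then obtain e where "poly (char_poly X) e = 0" using fundamental_theorem_of_algebra by blast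
  then obtain z where z: "z \<in> carrier_vec ?n" "z \<noteq> 0\<^sub>v ?n" and ze: "X *\<^sub>v z = e \<cdot>\<^sub>v z"
    using eigenvalue_root_char_poly[OF X] X unfolding eigenvalue_def eigenvector_def by auto
  define r where "r = sqrt (Re (z \<bullet>c z))"
  define u where "u = complex_of_real (1 / r) \<cdot>\<^sub>v z"
  have zz: "z \<bullet>c z = complex_of_real (r * r)" and r: "r > 0"
  proof -
    have pos: "Re (z \<bullet>c z) > 0" by (rule cscalar_prod_self_pos[OF z])
    then show "r > 0" by (simp add: r_def)
    have "z \<bullet>c z = complex_of_real (Re (z \<bullet>c z))"
      unfolding cscalar_prod_self by (simp only: Re_complex_of_real)
    also have "Re (z \<bullet>c z) = r * r" using pos by (simp add: r_def del: conjugate_square_greater_0_vec)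
    finally show "z \<bullet>c z = complex_of_real (r * r)" .
  qed
  have u: "u \<in> carrier_vec ?n" using z by (simp add: u_def)
  have uu: "u \<bullet>c u = 1"
    unfolding u_def using z r zz by (simp add: conjugate_smult_vec)
  then have u0: "u \<noteq> 0\<^sub>v ?n" by auto
  have ue: "X *\<^sub>v u = e \<cdot>\<^sub>v u"
    unfolding u_def using X z ze by (simp add: mult_mat_vec smult_smult_assoc mult.commute)
  have er: "e = complex_of_real (Re e)"
    by (rule hermitian_eigenvalue_real[OF X herm z ze])
  obtain V where V: "V \<in> carrier_mat ?n m" and VV: "adj V * V = 1\<^sub>m m" and Vu: "adj V *\<^sub>v u = 0\<^sub>v m"
    and proj: "\<And>x. x \<in> carrier_vec ?n \<Longrightarrow> x \<bullet>c u = 0 \<Longrightarrow> V *\<^sub>v (adj V *\<^sub>v x) = x"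
    using orthogonal_complement[OF u u0] by blast
  define Y where "Y = adj V * X * V"
  have Y: "Y \<in> carrier_mat m m" "adj Y = Y"
    using V X herm by (auto simp: Y_def adj_mult mult_assoc_dim)
  obtain U' d where D: "eigen_decomp m U' d Y" using Suc.IH[OF Y] by blast
  note U' = eigen_decompD(1)[OF D] and UU' = eigen_decompD(2)[OF D]
  define y where "y j = col U' j" for j
  have y: "y j \<in> carrier_vec m" if "j < m" for j using U' that by (simp add: y_def)
  have yy: "y j \<bullet>c y i = (if i = j then 1 else 0)" if "i < m" "j < m" for i j
    using index_adj_mult[OF U' U' that] UU' that by (simp add: y_def)
  have Vy_u: "(V *\<^sub>v y j) \<bullet>c u = 0" if "j < m" for j
    using cscalar_prod_adj[of "y j" V u] y[OF that] V u Vu by simp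
  have u_Vy: "u \<bullet>c (V *\<^sub>v y j) = 0" if "j < m" for j
    using cscalar_prod_adj[of u "adj V" "y j"] y[OF that] V u Vu by simp
  have Vy_Vy: "(V *\<^sub>v y j) \<bullet>c (V *\<^sub>v y i) = y j \<bullet>c y i" if "i < m" "j < m" for i j
    using cscalar_prod_adj[of "y j" V "V *\<^sub>v y i"] y that V VV
      mult_mat_vec_assoc_dim[of "adj V" V "y i"] by simp
  \<comment> \<open>The new eigenbasis is \<open>u\<close> followed by the eigenvectors of the
    compression, carried back by \<open>V\<close>.\<close>
  define U where "U = mat ?n ?n (\<lambda>(i,j). case j of 0 \<Rightarrow> u $ i | Suc j' \<Rightarrow> (V *\<^sub>v y j') $ i)"
  have U: "U \<in> carrier_mat ?n ?n" by (simp add: U_def)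
  have col0: "col U 0 = u" using u by (intro eq_vecI) (auto simp: U_def)
  have colS: "col U (Suc j) = V *\<^sub>v y j" if "j < m" for j
    using V that by (intro eq_vecI) (auto simp: U_def)
  have UU: "adj U * U = 1\<^sub>m ?n"
  proof (rule eq_matI)
    fix i j assume "i < dim_row (1\<^sub>m ?n :: complex mat)" "j < dim_col (1\<^sub>m ?n :: complex mat)"
    then have ij: "i < ?n" "j < ?n" by auto
    show "(adj U * U) $$ (i,j) = 1\<^sub>m ?n $$ (i,j)"
      unfolding index_adj_mult[OF U U ij] using ij
      by (cases i; cases j) (auto simp: col0 colS uu Vy_u u_Vy Vy_Vy yy)
  qed (use U in auto)
  define d' where "d' j = (case j of 0 \<Rightarrow> Re e | Suc j' \<Rightarrow> d j')" for j
  have "X *\<^sub>v col U j = complex_of_real (d' j) \<cdot>\<^sub>v col U j" if "j < ?n" for j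
  proof (cases j)
    case 0
    then show ?thesis using ue er by (simp add: col0 d'_def)
  next
    case (Suc j')
    then have j': "j' < m" using that by simp
    define x where "x = X *\<^sub>v (V *\<^sub>v y j')"
    have x: "x \<in> carrier_vec ?n" unfolding x_def using X by (intro carrier_vecI) auto
    \<comment> \<open>A Hermitian matrix maps the complement of its eigenvector \<open>u\<close>
      into itself. So \<open>V * adj V\<close> fixes \<open>x\<close>, and an eigenvector of the
      compression becomes one of \<open>X\<close>.\<close>
    have "x \<bullet>c u = (V *\<^sub>v y j') \<bullet>c (X *\<^sub>v u)"
      unfolding x_def using cscalar_prod_adj[of "V *\<^sub>v y j'" X u] X V u herm by simp
    also have "\<dots> = 0"
      unfolding ue using Vy_u[OF j'] u V y[OF j'] by (simp add: conjugate_smult_vec)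
    finally have "V *\<^sub>v (adj V *\<^sub>v x) = x" by (rule proj[OF x])
    moreover have "adj V *\<^sub>v x = Y *\<^sub>v y j'"
      unfolding x_def Y_def using V X y[OF j'] by (simp add: mult_mat_vec_assoc_dim)
    moreover have "Y *\<^sub>v y j' = complex_of_real (d j') \<cdot>\<^sub>v y j'"
      unfolding y_def by (rule eigen_decomp_col[OF D j'])
    ultimately have "x = complex_of_real (d j') \<cdot>\<^sub>v (V *\<^sub>v y j')"
      using V y[OF j'] by (simp add: mult_mat_vec)
    then show ?thesis using Suc j' by (simp add: colS x_def d'_def)
  qed
  from eigen_decompI[OF X U UU this] show ?case by blast
qed

lemma eigen_decomp_reindex:
  assumes D: "eigen_decomp n U d X" and p: "bij_betw p {..<n} {..<n}"
  shows "\<exists>U'. eigen_decomp n U' (\<lambda>j. d (p j)) X"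
proof -
  note U = eigen_decompD(1)[OF D]
  have pn: "p j < n" if "j < n" for j using bij_betwE[OF p] that by auto
  define U' where "U' = mat n n (\<lambda>(i,j). U $$ (i, p j))"
  have U': "U' \<in> carrier_mat n n" by (simp add: U'_def)
  have col: "col U' j = col U (p j)" if "j < n" for j
    using U pn that by (intro eq_vecI) (auto simp: U'_def)
  have UU: "adj U' * U' = 1\<^sub>m n"
  proof (rule eq_matI)
    fix i j assume "i < dim_row (1\<^sub>m n :: complex mat)" "j < dim_col (1\<^sub>m n :: complex mat)"
    then have ij: "i < n" "j < n" by auto
    have "(adj U' * U') $$ (i,j) = (adj U * U) $$ (p i, p j)"
      unfolding index_adj_mult[OF U' U' ij] index_adj_mult[OF U U pn[OF ij(1)] pn[OF ij(2)]]
      by (simp only: col ij)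
    also have "\<dots> = 1\<^sub>m n $$ (i,j)"
      using ij pn inj_on_eq_iff[OF bij_betw_imp_inj_on[OF p]]
      by (simp add: eigen_decompD(2)[OF D])
    finally show "(adj U' * U') $$ (i,j) = 1\<^sub>m n $$ (i,j)" .
  qed (use U' in auto)
  have "X *\<^sub>v col U' j = complex_of_real (d (p j)) \<cdot>\<^sub>v col U' j" if "j < n" for j
    unfolding col[OF that] by (rule eigen_decomp_col[OF D pn[OF that]])
  from eigen_decompI[OF eigen_decompD(5)[OF D] U' UU this] show ?thesis by blast
qed

section \<open>From diagonalizations to the sorted eigenvalue list\<close>

lemma proots_prod_list: "proots (\<Prod>a\<leftarrow>as. [:- a, 1:]) = mset (as :: complex list)"
proof (induction as)
  case (Cons a as)
  have "(\<Prod>a\<leftarrow>as. [:- a, 1:]) \<noteq> 0" by (auto simp: prod_list_zero_iff)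
  then have "proots ([:- a, 1:] * (\<Prod>a\<leftarrow>as. [:- a, 1:])) = proots [:- a, 1:] + proots (\<Prod>a\<leftarrow>as. [:- a, 1:])"
    by (intro proots_mult) auto
  then show ?case using Cons by simp
qed simp

text \<open>\<open>X\<close> is similar to the diagonal matrix of \<open>d\<close>, so its
  characteristic polynomial splits into the factors with roots \<open>d j\<close>. This links the
  eigenvalues, defined as roots, to diagonalizations.\<close>

lemma real_eigvals_eigen_decomp:
  assumes D: "eigen_decomp n U d X"
  shows "mset (real_eigvals X) = mset (map d [0..<n])"
proof -
  let ?D = "mat_diag n (\<lambda>i. complex_of_real (d i))"
  note E = eigen_decompD[OF D]
  have "similar_mat X ?D"
    by (rule similar_matI[of _ _ U "adj U" n]) (use E(1-5) adj_carrier in auto)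
  then have "char_poly X = char_poly ?D" by (rule char_poly_similar)
  also have "\<dots> = (\<Prod>a\<leftarrow>diag_mat ?D. [:- a, 1:])"
    by (rule char_poly_upper_triangular[of _ n]) (auto simp: mat_diag_def upper_triangular_def)
  also have "diag_mat ?D = map (\<lambda>i. complex_of_real (d i)) [0..<n]"
    by (auto simp: diag_mat_def mat_diag_def)
  finally have "proots (char_poly X) = mset (map (\<lambda>i. complex_of_real (d i)) [0..<n])"
    by (simp only: proots_prod_list)
  then show ?thesis by (simp add: real_eigvals_def multiset.map_comp o_def)
qed

lemma sorted_real_eigvals: "sorted_wrt (\<ge>) (real_eigvals X)"
  unfolding real_eigvals_def by (simp add: sorted_wrt_rev)

lemma eigval_antimono:
  assumes "X \<in> carrier_mat n n" "i \<le> j" "1 \<le> i" "j \<le> n"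
  shows "eigval j X \<le> eigval i X"
proof (cases "i = j")
  case False
  then show ?thesis
    using sorted_wrt_nth_less[OF sorted_real_eigvals, of "i - 1" "j - 1" X] assms
    by (auto simp: eigval_def length_real_eigvals)
qed simp

text \<open>A decreasing list is determined by its multiset. The lists are reversed in the proof
  because \<open>sort\<close> is ascending.\<close>

lemma eigval_eigen_decomp:
  assumes D: "eigen_decomp n U d X" and d: "\<And>i j. i \<le> j \<Longrightarrow> j < n \<Longrightarrow> d j \<le> d i" and t: "1 \<le> t" "t \<le> n"
  shows "eigval t X = d (t - 1)"
proof -
  have "sorted_wrt (\<ge>) (map d [0..<n])"
    by (auto simp: sorted_wrt_iff_nth_less intro: d)
  then have "sort (rev (map d [0..<n])) = rev (map d [0..<n])"
    by (intro properties_for_sort) (simp_all only: sorted_wrt_rev)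
  moreover have "sort (rev (map d [0..<n])) = rev (real_eigvals X)"
    using real_eigvals_eigen_decomp[OF D] sorted_real_eigvals[of X]
    by (intro properties_for_sort) (simp_all only: sorted_wrt_rev mset_rev)
  ultimately have "real_eigvals X = map d [0..<n]" by simp
  then show ?thesis using t by (simp add: eigval_def)
qed

text \<open>The columns of an arbitrary diagonalization are permuted until the values are in
  decreasing order; the permutation comes from equality of multisets.\<close>

lemma hermitian_spectral:
  assumes X: "X \<in> carrier_mat n n" "adj X = X"
  obtains U where "eigen_decomp n U (\<lambda>j. eigval (Suc j) X) X"
proof -
  obtain U d where D: "eigen_decomp n U d X" using hermitian_eigen_decomp[OF X] by blast
  obtain p where p: "p permutes {..<n}" "permute_list p (map d [0..<n]) = real_eigvals X"
    using mset_eq_permutation[OF real_eigvals_eigen_decomp[OF D]] by auto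
  have "eigval (Suc j) X = d (p j)" if "j < n" for j
  proof -
    have "p j < n" using permutes_in_image[OF p(1), of j] that by simp
    moreover have "real_eigvals X ! j = map d [0..<n] ! p j"
      unfolding p(2)[symmetric] using p(1) that by (intro permute_list_nth) auto
    ultimately show ?thesis by (simp add: eigval_def)
  qed
  moreover obtain U' where "eigen_decomp n U' (\<lambda>j. d (p j)) X"
    using eigen_decomp_reindex[OF D permutes_imp_bij[OF p(1)]] by blast
  \<comment> \<open>The two value functions agree only below \<open>n\<close>, which is all that the
    diagonal matrix sees.\<close>
  ultimately have "eigen_decomp n U' (\<lambda>j. eigval (Suc j) X) X"
    unfolding eigen_decomp_def mat_diag_def by (smt (verit) cong_mat prod.case)
  then show ?thesis by (rule that)
qed

lemma det_eigen_decomp: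
  assumes D: "eigen_decomp n U d X"
  shows "det X = complex_of_real (\<Prod>j<n. d j)"
proof -
  let ?D = "mat_diag n (\<lambda>i. complex_of_real (d i))"
  note E = eigen_decompD[OF D]
  have "similar_mat X ?D"
    by (rule similar_matI[of _ _ U "adj U" n]) (use E(1-5) adj_carrier in auto)
  then have "det X = det ?D" by (rule det_similar)
  also have "\<dots> = prod_list (diag_mat ?D)"
    by (rule det_upper_triangular[of _ n]) (auto simp: mat_diag_def upper_triangular_def)
  also have "\<dots> = (\<Prod>j<n. complex_of_real (d j))"
    unfolding prod_list_diag_prod by (simp add: mat_diag_def atLeast0LessThan)
  finally show ?thesis by simp
qed

section \<open>Courant-Fischer bounds and interlacing\<close>

text \<open>Pad \<open>M\<close> to a square matrix with zero rows. Row \<open>l\<close> is then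
  zero, so the transpose kills the unit vector \<open>l\<close>, the determinant vanishes, and the
  padded matrix has a kernel.\<close>

lemma wide_matrix_kernel:
  fixes M :: "complex mat"
  assumes M: "M \<in> carrier_mat l m" and lm: "l < m"
  obtains v where "v \<in> carrier_vec m" "v \<noteq> 0\<^sub>v m" "M *\<^sub>v v = 0\<^sub>v l"
proof -
  define N where "N = mat m m (\<lambda>(i,j). if i < l then M $$ (i,j) else 0)"
  have N: "N \<in> carrier_mat m m" by (simp add: N_def)
  have "transpose_mat N *\<^sub>v unit_vec m l = 0\<^sub>v m"
    using lm by (intro eq_vecI) (auto simp: N_def)
  moreover have "unit_vec m l \<noteq> (0\<^sub>v m :: complex vec)" using lm by simp
  ultimately have "\<exists>v. v \<in> carrier_vec m \<and> v \<noteq> 0\<^sub>v m \<and> transpose_mat N *\<^sub>v v = 0\<^sub>v m"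
    by (intro exI[of _ "unit_vec m l"]) auto
  moreover have "transpose_mat N \<in> carrier_mat m m" using N by simp
  ultimately have "det (transpose_mat N) = 0" by (simp only: det_0_iff_vec_prod_zero_field)
  then have "det N = 0" by (simp add: det_transpose[OF N])
  then obtain v where v: "v \<in> carrier_vec m" "v \<noteq> 0\<^sub>v m" "N *\<^sub>v v = 0\<^sub>v m"
    using det_0_iff_vec_prod_zero_field[OF N] by auto
  have "M *\<^sub>v v = 0\<^sub>v l"
  proof (rule eq_vecI)
    fix i assume "i < dim_vec (0\<^sub>v l :: complex vec)"
    then have i: "i < l" by simp
    have "(M *\<^sub>v v) $ i = (N *\<^sub>v v) $ i"
      using i lm M v(1) by (auto simp: N_def scalar_prod_def)
    then show "(M *\<^sub>v v) $ i = 0\<^sub>v l $ i" using v(3) i lm by simp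
  qed (use M in auto)
  with v(1,2) show ?thesis by (rule that)
qed

text \<open>These are \<open>r\<close> homogeneous linear conditions on \<open>m > r\<close>
  unknowns. This is the dimension count behind the Courant-Fischer bounds.\<close>

lemma vec_with_vanishing_coordinates:
  fixes U :: "complex mat"
  assumes U: "U \<in> carrier_mat n n" and Y: "Y \<in> carrier_mat n m" and r: "l + r \<le> n" "r < m"
  obtains v where "v \<in> carrier_vec m" "v \<noteq> 0\<^sub>v m"
    "\<And>j. l \<le> j \<Longrightarrow> j < l + r \<Longrightarrow> (adj U *\<^sub>v (Y *\<^sub>v v)) $ j = 0"
proof -
  define M where "M = mat r m (\<lambda>(i,j). (adj U * Y) $$ (l + i, j))"
  obtain v where v: "v \<in> carrier_vec m" "v \<noteq> 0\<^sub>v m" "M *\<^sub>v v = 0\<^sub>v r"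
    using wide_matrix_kernel[of M r m] r by (auto simp: M_def)
  have "(adj U *\<^sub>v (Y *\<^sub>v v)) $ j = 0" if j: "l \<le> j" "j < l + r" for j
  proof -
    have "(adj U *\<^sub>v (Y *\<^sub>v v)) $ j = ((adj U * Y) *\<^sub>v v) $ j"
      using U Y v(1) by (simp add: mult_mat_vec_assoc_dim)
    also have "\<dots> = row (adj U * Y) j \<bullet> v" using U j r by simp
    also have "row (adj U * Y) j = row M (j - l)"
      using U Y j r by (intro eq_vecI) (auto simp: M_def)
    also have "row M (j - l) \<bullet> v = (M *\<^sub>v v) $ (j - l)" using j by (simp add: M_def)
    also have "\<dots> = 0" using v(3) j by simp
    finally show ?thesis .
  qed
  with v(1,2) show ?thesis by (rule that)
qed

text \<open>Courant-Fischer: the \<open>m\<close>-dimensional range of \<open>Y\<close> contains a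
  nonzero vector whose \<open>m - 1\<close> leading eigencoordinates vanish. There the Rayleigh
  quotient is at least \<open>c\<close> and at most \<open>eigval m X\<close>.\<close>

lemma eigval_ge_of_form:
  assumes X: "X \<in> carrier_mat n n" "adj X = X" and Y: "Y \<in> carrier_mat n m" and m: "1 \<le> m" "m \<le> n"
    and inj: "\<And>v. v \<in> carrier_vec m \<Longrightarrow> v \<noteq> 0\<^sub>v m \<Longrightarrow> Y *\<^sub>v v \<noteq> 0\<^sub>v n"
    and form: "\<And>v. v \<in> carrier_vec m \<Longrightarrow>
      c * Re ((Y *\<^sub>v v) \<bullet>c (Y *\<^sub>v v)) \<le> Re ((X *\<^sub>v (Y *\<^sub>v v)) \<bullet>c (Y *\<^sub>v v))"
  shows "c \<le> eigval m X"
proof -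
  obtain U where D: "eigen_decomp n U (\<lambda>j. eigval (Suc j) X) X" by (rule hermitian_spectral[OF X])
  have r: "0 + (m - 1) \<le> n" "m - 1 < m" using m by auto
  obtain v where v: "v \<in> carrier_vec m" "v \<noteq> 0\<^sub>v m"
    and v0: "\<And>j. 0 \<le> j \<Longrightarrow> j < 0 + (m - 1) \<Longrightarrow> (adj U *\<^sub>v (Y *\<^sub>v v)) $ j = 0"
    using vec_with_vanishing_coordinates[OF eigen_decompD(1)[OF D] Y r] by blast
  define w where "w = Y *\<^sub>v v"
  have w: "w \<in> carrier_vec n" "w \<noteq> 0\<^sub>v n"
    using Y v(1) inj[OF v] by (simp_all add: w_def)
  define a where "a j = (cmod ((adj U *\<^sub>v w) $ j))\<^sup>2" for j
  have Q: "Re (w \<bullet>c w) = (\<Sum>j<n. a j)" and "Re ((X *\<^sub>v w) \<bullet>c w) = (\<Sum>j<n. eigval (Suc j) X * a j)"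
    unfolding eigen_decomp_form[OF D w(1)] a_def by (simp_all only: Re_complex_of_real)
  moreover have "(\<Sum>j<n. eigval (Suc j) X * a j) \<le> (\<Sum>j<n. eigval m X * a j)"
  proof (rule sum_mono)
    fix j assume j: "j \<in> {..<n}"
    show "eigval (Suc j) X * a j \<le> eigval m X * a j"
    proof (cases "j < m - 1")
      case True
      then have "a j = 0" using v0[of j] by (simp add: a_def w_def del: index_mult_mat_vec)
      then show ?thesis by simp
    next
      case False
      then have "eigval (Suc j) X \<le> eigval m X" using m j by (intro eigval_antimono[OF X(1)]) auto
      then show ?thesis by (rule mult_right_mono) (simp add: a_def)
    qed
  qed
  moreover have "c * Re (w \<bullet>c w) \<le> Re ((X *\<^sub>v w) \<bullet>c w)" using form[OF v(1)] by (simp add: w_def)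
  ultimately have "c * Re (w \<bullet>c w) \<le> eigval m X * Re (w \<bullet>c w)" by (simp add: sum_distrib_left)
  then show ?thesis using cscalar_prod_self_pos[OF w] by simp
qed

text \<open>The mirror image: the \<open>m - 1\<close> trailing eigencoordinates are made to vanish,
  so the Rayleigh quotient is bounded below by eigenvalue number \<open>n - m + 1\<close>.\<close>

lemma eigval_le_of_form:
  assumes X: "X \<in> carrier_mat n n" "adj X = X" and Y: "Y \<in> carrier_mat n m" and m: "1 \<le> m" "m \<le> n"
    and inj: "\<And>v. v \<in> carrier_vec m \<Longrightarrow> v \<noteq> 0\<^sub>v m \<Longrightarrow> Y *\<^sub>v v \<noteq> 0\<^sub>v n"
    and form: "\<And>v. v \<in> carrier_vec m \<Longrightarrow>
      Re ((X *\<^sub>v (Y *\<^sub>v v)) \<bullet>c (Y *\<^sub>v v)) \<le> c * Re ((Y *\<^sub>v v) \<bullet>c (Y *\<^sub>v v))"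
  shows "eigval (n - m + 1) X \<le> c"
proof -
  obtain U where D: "eigen_decomp n U (\<lambda>j. eigval (Suc j) X) X" by (rule hermitian_spectral[OF X])
  have r: "n - m + 1 + (m - 1) \<le> n" "m - 1 < m" using m by auto
  obtain v where v: "v \<in> carrier_vec m" "v \<noteq> 0\<^sub>v m"
    and v0: "\<And>j. n - m + 1 \<le> j \<Longrightarrow> j < n - m + 1 + (m - 1) \<Longrightarrow> (adj U *\<^sub>v (Y *\<^sub>v v)) $ j = 0"
    using vec_with_vanishing_coordinates[OF eigen_decompD(1)[OF D] Y r] by blast
  define w where "w = Y *\<^sub>v v"
  have w: "w \<in> carrier_vec n" "w \<noteq> 0\<^sub>v n"
    using Y v(1) inj[OF v] by (simp_all add: w_def)
  define a where "a j = (cmod ((adj U *\<^sub>v w) $ j))\<^sup>2" for j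
  have Q: "Re (w \<bullet>c w) = (\<Sum>j<n. a j)" and "Re ((X *\<^sub>v w) \<bullet>c w) = (\<Sum>j<n. eigval (Suc j) X * a j)"
    unfolding eigen_decomp_form[OF D w(1)] a_def by (simp_all only: Re_complex_of_real)
  moreover have "(\<Sum>j<n. eigval (n - m + 1) X * a j) \<le> (\<Sum>j<n. eigval (Suc j) X * a j)"
  proof (rule sum_mono)
    fix j assume j: "j \<in> {..<n}"
    show "eigval (n - m + 1) X * a j \<le> eigval (Suc j) X * a j"
    proof (cases "n - m + 1 \<le> j")
      case True
      then have "a j = 0" using v0[of j] j m by (simp add: a_def w_def del: index_mult_mat_vec)
      then show ?thesis by simp
    next
      case False
      then have "eigval (n - m + 1) X \<le> eigval (Suc j) X"
        using m j by (intro eigval_antimono[OF X(1)]) auto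
      then show ?thesis by (rule mult_right_mono) (simp add: a_def)
    qed
  qed
  moreover have "Re ((X *\<^sub>v w) \<bullet>c w) \<le> c * Re (w \<bullet>c w)" using form[OF v(1)] by (simp add: w_def)
  ultimately have "eigval (n - m + 1) X * Re (w \<bullet>c w) \<le> c * Re (w \<bullet>c w)" by (simp add: sum_distrib_left)
  then show ?thesis using cscalar_prod_self_pos[OF w] by simp
qed

section \<open>Quadratic forms on spans of consecutive eigenvectors\<close>

definition column_block :: "'a mat \<Rightarrow> nat \<Rightarrow> nat \<Rightarrow> 'a mat" where
  "column_block U l t = mat (dim_row U) t (\<lambda>(i,j). U $$ (i, l + j))"

lemma column_block_carrier [simp]: "U \<in> carrier_mat n m \<Longrightarrow> column_block U l t \<in> carrier_mat n t"
  by (simp add: column_block_def)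

text \<open>Padding \<open>v\<close> with zeros to a vector \<open>e\<close> gives
  \<open>w = U *\<^sub>v e\<close>, so the eigencoordinates of \<open>w\<close> are the entries of
  \<open>v\<close>. In a decreasing eigenbasis, \<open>l = 0\<close> selects leading and
  \<open>l = n - t\<close> trailing eigenvectors.\<close>

lemma column_block_form:
  assumes D: "eigen_decomp n U d X" and lt: "l + t \<le> n" and v: "v \<in> carrier_vec t"
  defines "w \<equiv> column_block U l t *\<^sub>v v"
  shows "w \<bullet>c w = v \<bullet>c v"
    and "Re ((X *\<^sub>v w) \<bullet>c w) = (\<Sum>j<t. d (l + j) * (cmod (v $ j))\<^sup>2)"
proof -
  note U = eigen_decompD(1)[OF D]
  have w: "w \<in> carrier_vec n" using U by (intro carrier_vecI) (simp add: w_def column_block_def)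
  define e where "e = vec n (\<lambda>i. if l \<le> i \<and> i < l + t then v $ (i - l) else 0)"
  \<comment> \<open>Stated for any commutative monoid, as it serves both complex entries and real
    squared moduli.\<close>
  have shift: "(\<Sum>i<n. if l \<le> i \<and> i < l + t then g (i - l) i else 0) = (\<Sum>j<t. g j (l + j))"
    for g :: "nat \<Rightarrow> nat \<Rightarrow> 'b :: comm_monoid_add"
  proof -
    have "(\<Sum>j<t. g j (l + j)) = (\<Sum>i\<in>(\<lambda>j. l + j) ` {..<t}. g (i - l) i)"
      by (subst sum.reindex) auto
    also have "(\<lambda>j. l + j) ` {..<t} = {i \<in> {..<n}. l \<le> i \<and> i < l + t}"
    proof (intro equalityI subsetI)
      fix i assume "i \<in> {i \<in> {..<n}. l \<le> i \<and> i < l + t}"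
      then show "i \<in> (\<lambda>j. l + j) ` {..<t}" by (intro image_eqI[of _ _ "i - l"]) auto
    qed (use lt in auto)
    also have "(\<Sum>i\<in>\<dots>. g (i - l) i) = (\<Sum>i<n. if l \<le> i \<and> i < l + t then g (i - l) i else 0)"
      by (rule sum.inter_filter) simp
    finally show ?thesis by simp
  qed
  have wU: "w = U *\<^sub>v e"
  proof (rule eq_vecI)
    fix i assume "i < dim_vec (U *\<^sub>v e)"
    then have i: "i < n" using U by simp
    have "(U *\<^sub>v e) $ i = (\<Sum>j<n. if l \<le> j \<and> j < l + t then U $$ (i,j) * v $ (j - l) else 0)"
      using U i by (auto simp: e_def scalar_prod_def atLeast0LessThan intro!: sum.cong)
    also have "\<dots> = (\<Sum>j<t. U $$ (i, l + j) * v $ j)" by (rule shift)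
    also have "\<dots> = w $ i"
      using U i v by (auto simp: w_def column_block_def scalar_prod_def atLeast0LessThan)
    finally show "w $ i = (U *\<^sub>v e) $ i" by simp
  qed (use U w in auto)
  have e: "adj U *\<^sub>v w = e"
    unfolding wU using U eigen_decompD(2)[OF D] mult_mat_vec_assoc_dim[of "adj U" U e]
    by (simp add: e_def)
  have en: "(cmod (e $ j))\<^sup>2 = (if l \<le> j \<and> j < l + t then (cmod (v $ (j - l)))\<^sup>2 else 0)" if "j < n" for j
    using that by (simp add: e_def)
  have "w \<bullet>c w = complex_of_real (\<Sum>j<n. (cmod (e $ j))\<^sup>2)"
    using eigen_decomp_form(2)[OF D w] by (simp only: e)
  also have "(\<Sum>j<n. (cmod (e $ j))\<^sup>2) = (\<Sum>j<n. if l \<le> j \<and> j < l + t then (cmod (v $ (j - l)))\<^sup>2 else 0)"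
    using en by (intro sum.cong) auto
  also have "\<dots> = (\<Sum>j<t. (cmod (v $ j))\<^sup>2)" by (rule shift)
  also have "complex_of_real \<dots> = v \<bullet>c v"
    unfolding cscalar_prod_self using v by (simp only: carrier_vecD)
  finally show "w \<bullet>c w = v \<bullet>c v" .
  have "Re ((X *\<^sub>v w) \<bullet>c w) = (\<Sum>j<n. d j * (cmod (e $ j))\<^sup>2)"
    unfolding eigen_decomp_form(1)[OF D w] e by (simp only: Re_complex_of_real)
  also have "\<dots> = (\<Sum>j<n. if l \<le> j \<and> j < l + t then d j * (cmod (v $ (j - l)))\<^sup>2 else 0)"
    using en by (intro sum.cong) auto
  also have "\<dots> = (\<Sum>j<t. d (l + j) * (cmod (v $ j))\<^sup>2)" by (rule shift)
  finally show "Re ((X *\<^sub>v w) \<bullet>c w) = (\<Sum>j<t. d (l + j) * (cmod (v $ j))\<^sup>2)" .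
qed

lemma nonzero_of_cscalar_prod_eq:
  assumes "(w :: complex vec) \<bullet>c w = v \<bullet>c v" "v \<in> carrier_vec m" "v \<noteq> 0\<^sub>v m"
  shows "w \<noteq> 0\<^sub>v n"
  using cscalar_prod_self_pos[OF assms(2,3)] assms(1)[symmetric] by auto

lemma leading_block_form:
  assumes X: "X \<in> carrier_mat n n" and D: "eigen_decomp n U (\<lambda>j. eigval (Suc j) X) X"
    and t: "t \<le> n" and v: "v \<in> carrier_vec t"
  defines "w \<equiv> column_block U 0 t *\<^sub>v v"
  shows "eigval t X * Re (w \<bullet>c w) \<le> Re ((X *\<^sub>v w) \<bullet>c w)"
proof -
  have nv: "w \<bullet>c w = v \<bullet>c v"
    unfolding w_def by (rule column_block_form(1)[OF D _ v]) (use t in simp)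
  have "eigval t X * Re (w \<bullet>c w) = (\<Sum>j<t. eigval t X * (cmod (v $ j))\<^sup>2)"
    unfolding nv unfolding cscalar_prod_self
    using v by (simp only: Re_complex_of_real sum_distrib_left carrier_vecD)
  also have "\<dots> \<le> (\<Sum>j<t. eigval (Suc (0 + j)) X * (cmod (v $ j))\<^sup>2)"
    using t by (intro sum_mono mult_right_mono eigval_antimono[OF X]) auto
  also have "\<dots> = Re ((X *\<^sub>v w) \<bullet>c w)"
    unfolding w_def using column_block_form(2)[OF D _ v, of 0] t by simp
  finally show ?thesis .
qed

lemma trailing_block_form:
  assumes X: "X \<in> carrier_mat n n" and D: "eigen_decomp n U (\<lambda>j. eigval (Suc j) X) X"
    and t: "t \<le> n" and v: "v \<in> carrier_vec t"
  defines "w \<equiv> column_block U (n - t) t *\<^sub>v v"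
  shows "Re ((X *\<^sub>v w) \<bullet>c w) \<le> eigval (n - t + 1) X * Re (w \<bullet>c w)"
proof -
  have nv: "w \<bullet>c w = v \<bullet>c v"
    unfolding w_def by (rule column_block_form(1)[OF D _ v]) (use t in simp)
  have "Re ((X *\<^sub>v w) \<bullet>c w) = (\<Sum>j<t. eigval (Suc (n - t + j)) X * (cmod (v $ j))\<^sup>2)"
    unfolding w_def using column_block_form(2)[OF D _ v, of "n - t"] t by simp
  also have "\<dots> \<le> (\<Sum>j<t. eigval (n - t + 1) X * (cmod (v $ j))\<^sup>2)"
    using t by (intro sum_mono mult_right_mono eigval_antimono[OF X]) auto
  also have "\<dots> = eigval (n - t + 1) X * Re (w \<bullet>c w)"
    unfolding nv unfolding cscalar_prod_self
    using v by (simp only: Re_complex_of_real sum_distrib_left carrier_vecD)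
  finally show ?thesis .
qed

section \<open>Interlacing for compressions\<close>

lemma adj_congruence:
  assumes "X \<in> carrier_mat n n" "adj X = X" "V \<in> carrier_mat n k"
  shows "adj V * X * V \<in> carrier_mat k k" "adj (adj V * X * V) = adj V * X * V"
  using assms by (auto simp: adj_mult mult_assoc_dim)

lemma congruence_form:
  assumes "X \<in> carrier_mat n n" "V \<in> carrier_mat n k" "y \<in> carrier_vec k"
  shows "(adj V * X * V *\<^sub>v y) \<bullet>c y = (X *\<^sub>v (V *\<^sub>v y)) \<bullet>c (V *\<^sub>v y)"
  using cscalar_prod_adj[of "X *\<^sub>v (V *\<^sub>v y)" "adj V" y] assms
  by (simp add: mult_mat_vec_assoc_dim)

text \<open>One half of Cauchy interlacing: \<open>V\<close> carries the \<open>t\<close> leading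
  eigenvectors of the compression to a test space for \<open>X\<close> with unchanged Rayleigh
  quotients.\<close>

lemma eigval_compression_le:
  assumes X: "X \<in> carrier_mat n n" "adj X = X" and V: "V \<in> carrier_mat n k" "adj V * V = 1\<^sub>m k"
    and t: "1 \<le> t" "t \<le> k" "k \<le> n"
  shows "eigval t (adj V * X * V) \<le> eigval t X"
proof -
  define Z where "Z = adj V * X * V"
  have Z: "Z \<in> carrier_mat k k" "adj Z = Z" unfolding Z_def by (rule adj_congruence[OF X V(1)])+
  obtain U where D: "eigen_decomp k U (\<lambda>j. eigval (Suc j) Z) Z" by (rule hermitian_spectral[OF Z])
  note U = eigen_decompD(1)[OF D]
  define Y where "Y = column_block U 0 t"
  have Y: "Y \<in> carrier_mat k t" using U by (simp add: Y_def)
  have eq: "(V * Y) *\<^sub>v v = V *\<^sub>v (Y *\<^sub>v v)" if "v \<in> carrier_vec t" for v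
    using V Y that by (simp add: mult_mat_vec_assoc_dim)
  have Yv: "Y *\<^sub>v v \<in> carrier_vec k" for v using Y by (intro carrier_vecI) simp
  have nrm: "(V *\<^sub>v (Y *\<^sub>v v)) \<bullet>c (V *\<^sub>v (Y *\<^sub>v v)) = (Y *\<^sub>v v) \<bullet>c (Y *\<^sub>v v)" for v
    by (rule cscalar_prod_isometry[OF V Yv])
  have "eigval t Z \<le> eigval t X"
  proof (rule eigval_ge_of_form[OF X, of "V * Y"])
    fix v :: "complex vec" assume v: "v \<in> carrier_vec t"
    have nv: "(Y *\<^sub>v v) \<bullet>c (Y *\<^sub>v v) = v \<bullet>c v"
      unfolding Y_def by (rule column_block_form(1)[OF D _ v]) (use t in simp)
    show "V * Y *\<^sub>v v \<noteq> 0\<^sub>v n" if "v \<noteq> 0\<^sub>v t"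
      unfolding eq[OF v] by (rule nonzero_of_cscalar_prod_eq[OF _ v that]) (simp only: nrm nv)
    have "eigval t Z * Re ((Y *\<^sub>v v) \<bullet>c (Y *\<^sub>v v)) \<le> Re ((Z *\<^sub>v (Y *\<^sub>v v)) \<bullet>c (Y *\<^sub>v v))"
      unfolding Y_def by (rule leading_block_form[OF Z(1) D t(2) v])
    then show "eigval t Z * Re ((V * Y *\<^sub>v v) \<bullet>c (V * Y *\<^sub>v v))
        \<le> Re ((X *\<^sub>v (V * Y *\<^sub>v v)) \<bullet>c (V * Y *\<^sub>v v))"
      unfolding eq[OF v] nrm Z_def congruence_form[OF X(1) V(1) Yv] .
  qed (use V Y t in auto)
  then show ?thesis by (simp add: Z_def)
qed

text \<open>The other half of Cauchy interlacing, with trailing eigenvectors of the compression as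
  test space.\<close>

lemma eigval_compression_ge:
  assumes X: "X \<in> carrier_mat n n" "adj X = X" and V: "V \<in> carrier_mat n k" "adj V * V = 1\<^sub>m k"
    and t: "1 \<le> t" "t \<le> k" "k \<le> n"
  shows "eigval (n - k + t) X \<le> eigval t (adj V * X * V)"
proof -
  define Z where "Z = adj V * X * V"
  have Z: "Z \<in> carrier_mat k k" "adj Z = Z" unfolding Z_def by (rule adj_congruence[OF X V(1)])+
  obtain U where D: "eigen_decomp k U (\<lambda>j. eigval (Suc j) Z) Z" by (rule hermitian_spectral[OF Z])
  note U = eigen_decompD(1)[OF D]
  \<comment> \<open>\<open>?m\<close> counts the eigenvectors of \<open>Z\<close> numbered
    \<open>t\<close> to \<open>k\<close>.\<close>
  let ?m = "k - t + 1"
  define Y where "Y = column_block U (k - ?m) ?m"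
  have Y: "Y \<in> carrier_mat k ?m" using U by (simp add: Y_def)
  have eq: "(V * Y) *\<^sub>v v = V *\<^sub>v (Y *\<^sub>v v)" if "v \<in> carrier_vec ?m" for v
    using V Y that by (simp add: mult_mat_vec_assoc_dim)
  have Yv: "Y *\<^sub>v v \<in> carrier_vec k" for v using Y by (intro carrier_vecI) simp
  have nrm: "(V *\<^sub>v (Y *\<^sub>v v)) \<bullet>c (V *\<^sub>v (Y *\<^sub>v v)) = (Y *\<^sub>v v) \<bullet>c (Y *\<^sub>v v)" for v
    by (rule cscalar_prod_isometry[OF V Yv])
  have mt: "k - ?m + 1 = t" "n - ?m + 1 = n - k + t" using t by auto
  have "eigval (n - ?m + 1) X \<le> eigval t Z"
  proof (rule eigval_le_of_form[OF X, of "V * Y"])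
    fix v :: "complex vec" assume v: "v \<in> carrier_vec ?m"
    have nv: "(Y *\<^sub>v v) \<bullet>c (Y *\<^sub>v v) = v \<bullet>c v"
      unfolding Y_def by (rule column_block_form(1)[OF D _ v]) (use t in simp)
    show "V * Y *\<^sub>v v \<noteq> 0\<^sub>v n" if "v \<noteq> 0\<^sub>v ?m"
      unfolding eq[OF v] by (rule nonzero_of_cscalar_prod_eq[OF _ v that]) (simp only: nrm nv)
    have "Re ((Z *\<^sub>v (Y *\<^sub>v v)) \<bullet>c (Y *\<^sub>v v)) \<le> eigval (k - ?m + 1) Z * Re ((Y *\<^sub>v v) \<bullet>c (Y *\<^sub>v v))"
      unfolding Y_def by (rule trailing_block_form[OF Z(1) D _ v]) (use t in simp)
    then show "Re ((X *\<^sub>v (V * Y *\<^sub>v v)) \<bullet>c (V * Y *\<^sub>v v))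
        \<le> eigval t Z * Re ((V * Y *\<^sub>v v) \<bullet>c (V * Y *\<^sub>v v))"
      unfolding eq[OF v] nrm mt unfolding Z_def congruence_form[OF X(1) V(1) Yv] .
  qed (use V Y t in auto)
  then show ?thesis by (simp only: Z_def mt)
qed

section \<open>Wielandt-type simultaneous compression\<close>

text \<open>When the range of \<open>V\<close> contains the \<open>t\<close> leading eigenvectors of
  \<open>X\<close>, these form a test space for the compression itself. So no index is lost, unlike
  in plain interlacing.\<close>

lemma eigval_compression_ge_leading:
  assumes X: "X \<in> carrier_mat n n" "adj X = X" and V: "V \<in> carrier_mat n k"
    and isom: "adj V * V = 1\<^sub>m k"
    and D: "eigen_decomp n U (\<lambda>j. eigval (Suc j) X) X" and t: "1 \<le> t" "t \<le> k" "k \<le> n"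
    and range: "\<And>v. v \<in> carrier_vec t \<Longrightarrow>
      V *\<^sub>v (adj V *\<^sub>v (column_block U 0 t *\<^sub>v v)) = column_block U 0 t *\<^sub>v v"
  shows "eigval t X \<le> eigval t (adj V * X * V)"
proof -
  define B where "B = column_block U 0 t"
  have B: "B \<in> carrier_mat n t" using eigen_decompD(1)[OF D] by (simp add: B_def)
  have Y: "adj V * B \<in> carrier_mat k t" using V B by (intro carrier_matI) auto
  define y where "y v = adj V *\<^sub>v (B *\<^sub>v v)" for v
  have y: "y v \<in> carrier_vec k" for v using V by (intro carrier_vecI) (simp add: y_def)
  have eq: "(adj V * B) *\<^sub>v v = y v" if "v \<in> carrier_vec t" for v
    using V B that by (simp add: mult_mat_vec_assoc_dim y_def)
  have Vy: "V *\<^sub>v y v = B *\<^sub>v v" if "v \<in> carrier_vec t" for v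
    using range[OF that] by (simp add: y_def B_def)
  have nrm: "y v \<bullet>c y v = (B *\<^sub>v v) \<bullet>c (B *\<^sub>v v)" if "v \<in> carrier_vec t" for v
    using cscalar_prod_isometry[OF V isom y, of v] by (simp only: Vy[OF that])
  show ?thesis
  proof (rule eigval_ge_of_form[OF adj_congruence[OF X V] Y t(1,2)])
    fix v :: "complex vec" assume v: "v \<in> carrier_vec t"
    have "(B *\<^sub>v v) \<bullet>c (B *\<^sub>v v) = v \<bullet>c v"
      unfolding B_def by (rule column_block_form(1)[OF D _ v]) (use t in simp)
    then show "adj V * B *\<^sub>v v \<noteq> 0\<^sub>v k" if "v \<noteq> 0\<^sub>v t"
      unfolding eq[OF v] using that by (intro nonzero_of_cscalar_prod_eq[OF _ v that]) (simp only: nrm[OF v])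
    have "eigval t X * Re ((B *\<^sub>v v) \<bullet>c (B *\<^sub>v v)) \<le> Re ((X *\<^sub>v (B *\<^sub>v v)) \<bullet>c (B *\<^sub>v v))"
      unfolding B_def by (rule leading_block_form[OF X(1) D _ v]) (use t in simp)
    then show "eigval t X * Re ((adj V * B *\<^sub>v v) \<bullet>c (adj V * B *\<^sub>v v))
        \<le> Re ((adj V * X * V *\<^sub>v (adj V * B *\<^sub>v v)) \<bullet>c (adj V * B *\<^sub>v v))"
      unfolding eq[OF v] nrm[OF v] congruence_form[OF X(1) V y] Vy[OF v] .
  qed
qed

text \<open>The dual case: the range of \<open>V\<close> contains the \<open>m\<close> trailing
  eigenvectors. Counted from the bottom the index is kept; counted from the top it drops by
  \<open>n - k\<close>.\<close>

lemma eigval_compression_le_trailing: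
  assumes X: "X \<in> carrier_mat n n" "adj X = X" and V: "V \<in> carrier_mat n k"
    and isom: "adj V * V = 1\<^sub>m k"
    and D: "eigen_decomp n U (\<lambda>j. eigval (Suc j) X) X" and m: "1 \<le> m" "m \<le> k" "k \<le> n"
    and range: "\<And>v. v \<in> carrier_vec m \<Longrightarrow>
      V *\<^sub>v (adj V *\<^sub>v (column_block U (n - m) m *\<^sub>v v)) = column_block U (n - m) m *\<^sub>v v"
  shows "eigval (k - m + 1) (adj V * X * V) \<le> eigval (n - m + 1) X"
proof -
  define B where "B = column_block U (n - m) m"
  have B: "B \<in> carrier_mat n m" using eigen_decompD(1)[OF D] by (simp add: B_def)
  have Y: "adj V * B \<in> carrier_mat k m" using V B by (intro carrier_matI) auto
  define y where "y v = adj V *\<^sub>v (B *\<^sub>v v)" for v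
  have y: "y v \<in> carrier_vec k" for v using V by (intro carrier_vecI) (simp add: y_def)
  have eq: "(adj V * B) *\<^sub>v v = y v" if "v \<in> carrier_vec m" for v
    using V B that by (simp add: mult_mat_vec_assoc_dim y_def)
  have Vy: "V *\<^sub>v y v = B *\<^sub>v v" if "v \<in> carrier_vec m" for v
    using range[OF that] by (simp add: y_def B_def)
  have nrm: "y v \<bullet>c y v = (B *\<^sub>v v) \<bullet>c (B *\<^sub>v v)" if "v \<in> carrier_vec m" for v
    using cscalar_prod_isometry[OF V isom y, of v] by (simp only: Vy[OF that])
  show ?thesis
  proof (rule eigval_le_of_form[OF adj_congruence[OF X V] Y m(1,2)])
    fix v :: "complex vec" assume v: "v \<in> carrier_vec m"
    have "(B *\<^sub>v v) \<bullet>c (B *\<^sub>v v) = v \<bullet>c v"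
      unfolding B_def by (rule column_block_form(1)[OF D _ v]) (use m in simp)
    then show "adj V * B *\<^sub>v v \<noteq> 0\<^sub>v k" if "v \<noteq> 0\<^sub>v m"
      unfolding eq[OF v] using that by (intro nonzero_of_cscalar_prod_eq[OF _ v that]) (simp only: nrm[OF v])
    have "Re ((X *\<^sub>v (B *\<^sub>v v)) \<bullet>c (B *\<^sub>v v)) \<le> eigval (n - m + 1) X * Re ((B *\<^sub>v v) \<bullet>c (B *\<^sub>v v))"
      unfolding B_def by (rule trailing_block_form[OF X(1) D _ v]) (use m in simp)
    then show "Re ((adj V * X * V *\<^sub>v (adj V * B *\<^sub>v v)) \<bullet>c (adj V * B *\<^sub>v v))
        \<le> eigval (n - m + 1) X * Re ((adj V * B *\<^sub>v v) \<bullet>c (adj V * B *\<^sub>v v))"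
      unfolding eq[OF v] nrm[OF v] congruence_form[OF X(1) V y] Vy[OF v] .
  qed
qed

lemma strict_mono_on_nat_gap:
  fixes i :: "nat \<Rightarrow> nat"
  assumes "strict_mono_on {a..b} i" "a \<le> s" "s \<le> t" "t \<le> b"
  shows "i s + (t - s) \<le> i t"
  using assms(3,4)
proof (induction t rule: dec_induct)
  case (step t)
  have "i t < i (Suc t)"
    by (rule strict_mono_onD[OF assms(1)]) (use step assms(2) in auto)
  then show ?case using step by simp
qed simp

lemma column_block_orthogonal:
  assumes U: "U \<in> carrier_mat n n" and z: "z \<in> carrier_vec n" and lt: "l + t \<le> n"
    and v: "v \<in> carrier_vec t" and orth: "\<And>s. s < t \<Longrightarrow> (adj U *\<^sub>v z) $ (l + s) = 0"
  shows "(column_block U l t *\<^sub>v v) \<bullet>c z = 0"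
proof -
  have B: "column_block U l t \<in> carrier_mat n t" using U by simp
  have "adj (column_block U l t) *\<^sub>v z = 0\<^sub>v t"
  proof (rule eq_vecI)
    fix s assume "s < dim_vec (0\<^sub>v t :: complex vec)"
    then have s: "s < t" by simp
    have "(adj (column_block U l t) *\<^sub>v z) $ s = (adj U *\<^sub>v z) $ (l + s)"
      using U z s lt by (auto simp: column_block_def scalar_prod_def intro!: sum.cong)
    then show "(adj (column_block U l t) *\<^sub>v z) $ s = 0\<^sub>v t $ s"
      using orth[OF s] s by (simp del: index_mult_mat_vec)
  qed (use B in auto)
  then show ?thesis using cscalar_prod_adj[of v "column_block U l t" z] B v z by simp
qed

text \<open>Induction on \<open>n\<close> with \<open>k\<close> fixed: each step gives up one
  dimension and relabels the indices, and the isometries are composed. A single \<open>V\<close>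
  must serve both matrices, since Hua's identity is later compressed by it.\<close>

lemma simultaneous_compression:
  fixes M F :: "complex mat" and i :: "nat \<Rightarrow> nat"
  assumes "M \<in> carrier_mat n n" "adj M = M" "F \<in> carrier_mat n n" "adj F = F"
    and "strict_mono_on {1..k} i" "\<forall>t\<in>{1..k}. 1 \<le> i t \<and> i t \<le> n"
  shows "\<exists>V. V \<in> carrier_mat n k \<and> adj V * V = 1\<^sub>m k \<and>
    (\<forall>t\<in>{1..k}. eigval t (adj V * M * V) \<le> eigval (i t) M \<and> eigval (i t) F \<le> eigval t (adj V * F * V))"
  using assms
proof (induction n arbitrary: M F i)
  case 0
  then have "k = 0" by (cases k) auto
  then show ?case by (intro exI[of _ "1\<^sub>m 0"]) auto
next
  case (Suc m)
  let ?n = "Suc m"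
  note M = Suc.prems(1,2) and F = Suc.prems(3,4) and mono = Suc.prems(5) and rng = Suc.prems(6)
  have lower: "t \<le> i t" and upper: "i t + (k - t) \<le> ?n" if "t \<in> {1..k}" for t
  proof -
    have "1 \<in> {1..k}" "k \<in> {1..k}" using that by auto
    then have "1 \<le> i 1" "i k \<le> ?n" using rng by blast+
    then show "t \<le> i t" "i t + (k - t) \<le> ?n"
      using strict_mono_on_nat_gap[OF mono, of 1 t] strict_mono_on_nat_gap[OF mono, of t k] that by auto
  qed
  show ?case
  proof (cases "k < ?n")
    \<comment> \<open>With \<open>k = n\<close> the spacing bounds \<open>lower\<close> and
      \<open>upper\<close> force \<open>i t = t\<close>, and the identity matrix gives
      equality.\<close>
    case False
    have "k \<le> ?n" using upper[of k] lower[of k] by (cases "k = 0") auto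
    with False have k: "k = ?n" by simp
    have "i t = t" if "t \<in> {1..k}" for t using lower[OF that] upper[OF that] that k by auto
    then show ?thesis
      using M F by (intro exI[of _ "1\<^sub>m ?n"]) (auto simp: k)
  next
    case True
    have "\<not> {1..?n} \<subseteq> i ` {1..k}"
    proof
      assume "{1..?n} \<subseteq> i ` {1..k}"
      then have "card {1..?n} \<le> card (i ` {1..k})" by (intro card_mono) auto
      also have "\<dots> \<le> k" using card_image_le[of "{1..k}" i] by simp
      finally show False using True by simp
    qed
    then obtain j where "j \<in> {1..?n}" and notin: "j \<notin> i ` {1..k}" by blast
    then have j: "1 \<le> j" "j \<le> ?n" by auto
    have neq: "i t \<noteq> j" if "t \<in> {1..k}" for t using notin that by auto
    obtain UM where DM: "eigen_decomp ?n UM (\<lambda>j. eigval (Suc j) M) M" by (rule hermitian_spectral[OF M])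
    obtain UF where DF: "eigen_decomp ?n UF (\<lambda>j. eigval (Suc j) F) F" by (rule hermitian_spectral[OF F])
    note UM = eigen_decompD(1)[OF DM] and UF = eigen_decompD(1)[OF DF]
    text \<open>The \<open>j - 1\<close> leading eigenvectors of \<open>F\<close> and the \<open>n - j\<close> trailing ones of \<open>M\<close> lie in a
      common hyperplane. Compressing to it shifts the indices above \<open>j\<close> down by one, and the
      eigenvalues involved move in the right direction.\<close>
    define N where "N = mat m ?n (\<lambda>(r,c). if r < j - 1 then cnj (UF $$ (c,r)) else cnj (UM $$ (c, Suc r)))"
    have N: "N \<in> carrier_mat m ?n" by (simp add: N_def)
    \<comment> \<open>\<open>N\<close> has \<open>(j - 1) + (n - j) = m\<close> rows and one more
      column, so some nonzero \<open>z\<close> is orthogonal to all the chosen eigenvectors.\<close>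
    obtain z where z: "z \<in> carrier_vec ?n" "z \<noteq> 0\<^sub>v ?n" and Nz: "N *\<^sub>v z = 0\<^sub>v m"
      by (rule wide_matrix_kernel[OF N]) auto
    have orthF: "(adj UF *\<^sub>v z) $ r = 0" if "r < j - 1" for r
    proof -
      have r: "r < m" using that j by simp
      have "(adj UF *\<^sub>v z) $ r = (N *\<^sub>v z) $ r"
        using UF z that j r by (auto simp: N_def scalar_prod_def intro!: sum.cong)
      then show ?thesis using r by (simp add: Nz del: index_mult_mat_vec)
    qed
    have orthM: "(adj UM *\<^sub>v z) $ r = 0" if "j \<le> r" "r < ?n" for r
    proof -
      have r: "r - 1 < m" "Suc (r - 1) = r" "\<not> r - 1 < j - 1" using that j by auto
      have "(adj UM *\<^sub>v z) $ r = (N *\<^sub>v z) $ (r - 1)"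
        using UM z that r by (auto simp: N_def scalar_prod_def intro!: sum.cong)
      then show ?thesis using r by (simp add: Nz del: index_mult_mat_vec)
    qed
    obtain V where V: "V \<in> carrier_mat ?n m" and VV: "adj V * V = 1\<^sub>m m"
      and proj: "\<And>x. x \<in> carrier_vec ?n \<Longrightarrow> x \<bullet>c z = 0 \<Longrightarrow> V *\<^sub>v (adj V *\<^sub>v x) = x"
      using orthogonal_complement[OF z] by blast
    define i' where "i' t = (if i t < j then i t else i t - 1)" for t
    have mono': "strict_mono_on {1..k} i'"
    proof (rule strict_mono_onI)
      fix s t assume st: "s \<in> {1..k}" "t \<in> {1..k}" "s < t"
      then have "i s < i t" by (rule strict_mono_onD[OF mono])
      then show "i' s < i' t" using neq[OF st(1)] neq[OF st(2)] by (auto simp: i'_def)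
    qed
    have rng': "\<forall>t\<in>{1..k}. 1 \<le> i' t \<and> i' t \<le> m"
    proof
      fix t assume t: "t \<in> {1..k}"
      then have "1 \<le> i t \<and> i t \<le> ?n" using rng by blast
      then show "1 \<le> i' t \<and> i' t \<le> m" using neq[OF t] j by (auto simp: i'_def)
    qed
    define M' where "M' = adj V * M * V"
    define F' where "F' = adj V * F * V"
    have M': "M' \<in> carrier_mat m m" "adj M' = M'" and F': "F' \<in> carrier_mat m m" "adj F' = F'"
      unfolding M'_def F'_def by (rule adj_congruence[OF M V] adj_congruence[OF F V])+
    have leM: "eigval (i' t) M' \<le> eigval (i t) M" if t: "t \<in> {1..k}" for t
    proof (cases "i t < j")
      case True
      then show ?thesis
        using eigval_compression_le[OF M V VV, of "i t"] rng t j by (auto simp: M'_def i'_def)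
    next
      case False
      then have gt: "j < i t" "i t \<le> ?n" using neq[OF t] rng t by auto
      \<comment> \<open>The number of eigenvectors of \<open>M\<close> from index \<open>i t\<close>
        to the last. As \<open>j < i t\<close>, all of them lie in the hyperplane, so the index from
        the bottom is kept while the one from the top drops by one.\<close>
      let ?m = "?n - i t + 1"
      have "eigval (m - ?m + 1) M' \<le> eigval (?n - ?m + 1) M"
        unfolding M'_def
      proof (rule eigval_compression_le_trailing[OF M V VV DM])
        fix v :: "complex vec" assume v: "v \<in> carrier_vec ?m"
        have "(column_block UM (?n - ?m) ?m *\<^sub>v v) \<bullet>c z = 0"
          by (rule column_block_orthogonal[OF UM z(1) _ v orthM]) (use gt in auto)
        then show "V *\<^sub>v (adj V *\<^sub>v (column_block UM (?n - ?m) ?m *\<^sub>v v)) = column_block UM (?n - ?m) ?m *\<^sub>v v"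
          by (intro proj mult_mat_vec_carrier[OF column_block_carrier[OF UM] v])
      qed (use gt j in auto)
      moreover have "m - ?m + 1 = i' t" "?n - ?m + 1 = i t" using gt j by (auto simp: i'_def)
      ultimately show ?thesis by (simp only:)
    qed
    have geF: "eigval (i t) F \<le> eigval (i' t) F'" if t: "t \<in> {1..k}" for t
    proof (cases "i t < j")
      case True
      have "eigval (i t) F \<le> eigval (i t) F'"
        unfolding F'_def
      proof (rule eigval_compression_ge_leading[OF F V VV DF])
        fix v :: "complex vec" assume v: "v \<in> carrier_vec (i t)"
        have "(column_block UF 0 (i t) *\<^sub>v v) \<bullet>c z = 0"
          by (rule column_block_orthogonal[OF UF z(1) _ v orthF]) (use True j in auto)
        then show "V *\<^sub>v (adj V *\<^sub>v (column_block UF 0 (i t) *\<^sub>v v)) = column_block UF 0 (i t) *\<^sub>v v"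
          by (intro proj mult_mat_vec_carrier[OF column_block_carrier[OF UF] v])
      qed (use True j rng t in auto)
      then show ?thesis using True by (simp add: i'_def)
    next
      \<comment> \<open>Here plain interlacing suffices: losing one dimension costs one index, which
        the passage from \<open>i t\<close> to \<open>i t - 1\<close> absorbs.\<close>
      case False
      then have gt: "j < i t" "i t \<le> ?n" using neq[OF t] rng t by auto
      then show ?thesis
        using eigval_compression_ge[OF F V VV, of "i t - 1"] j by (simp add: F'_def i'_def)
    qed
    obtain V' where V': "V' \<in> carrier_mat m k" "adj V' * V' = 1\<^sub>m k"
      and IH: "\<And>t. t \<in> {1..k} \<Longrightarrow> eigval t (adj V' * M' * V') \<le> eigval (i' t) M'"
        "\<And>t. t \<in> {1..k} \<Longrightarrow> eigval (i' t) F' \<le> eigval t (adj V' * F' * V')"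
      using Suc.IH[OF M' F' mono' rng'] by blast
    have comp: "adj (V * V') * X * (V * V') = adj V' * (adj V * X * V) * V'" if "X \<in> carrier_mat ?n ?n" for X
      using V V' that by (simp add: adj_mult mult_assoc_dim)
    have "adj (V * V') * (V * V') = adj V' * (adj V * V) * V'"
      using V V' by (simp add: adj_mult mult_assoc_dim)
    also have "\<dots> = 1\<^sub>m k" using VV V' by (simp add: mult_assoc_dim)
    finally have "adj (V * V') * (V * V') = 1\<^sub>m k" .
    moreover have "V * V' \<in> carrier_mat ?n k" using V V' by simp
    moreover have "\<forall>t\<in>{1..k}. eigval t (adj (V * V') * M * (V * V')) \<le> eigval (i t) M
        \<and> eigval (i t) F \<le> eigval t (adj (V * V') * F * (V * V'))"
      unfolding comp[OF M(1)] comp[OF F(1)] M'_def[symmetric] F'_def[symmetric]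
      using IH leM geF by (meson order_trans)
    ultimately show ?thesis by blast
  qed
qed

section \<open>Determinants of compressions\<close>

definition pos_semidef :: "nat \<Rightarrow> complex mat \<Rightarrow> bool" where
  "pos_semidef n M \<longleftrightarrow> M \<in> carrier_mat n n \<and> adj M = M \<and> (\<forall>v\<in>carrier_vec n. 0 \<le> Re ((M *\<^sub>v v) \<bullet>c v))"

lemma pos_semidefD:
  assumes "pos_semidef n M"
  shows "M \<in> carrier_mat n n" "adj M = M" "v \<in> carrier_vec n \<Longrightarrow> 0 \<le> Re ((M *\<^sub>v v) \<bullet>c v)"
  using assms by (auto simp: pos_semidef_def)

lemma pos_defD:
  assumes "pos_def M" "M \<in> carrier_mat n n"
  shows "adj M = M" "v \<in> carrier_vec n \<Longrightarrow> v \<noteq> 0\<^sub>v n \<Longrightarrow> 0 < Re ((M *\<^sub>v v) \<bullet>c v)"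
  using assms by (auto simp: pos_def_def)

lemma pos_defI:
  assumes "M \<in> carrier_mat n n" "adj M = M"
    and "\<And>v. v \<in> carrier_vec n \<Longrightarrow> v \<noteq> 0\<^sub>v n \<Longrightarrow> 0 < Re ((M *\<^sub>v v) \<bullet>c v)"
  shows "pos_def M"
  using assms by (auto simp: pos_def_def)

lemma pos_semidef_congruence:
  assumes "pos_semidef n M" "V \<in> carrier_mat n k"
  shows "pos_semidef k (adj V * M * V)"
  unfolding pos_semidef_def
proof (intro conjI ballI)
  note M = pos_semidefD[OF assms(1)]
  show "adj V * M * V \<in> carrier_mat k k" "adj (adj V * M * V) = adj V * M * V"
    by (rule adj_congruence[OF M(1,2) assms(2)])+
  fix v :: "complex vec" assume v: "v \<in> carrier_vec k"
  show "0 \<le> Re ((adj V * M * V *\<^sub>v v) \<bullet>c v)"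
    unfolding congruence_form[OF M(1) assms(2) v]
    by (rule M(3)) (rule mult_mat_vec_carrier[OF assms(2) v])
qed

lemma pos_semidef_one: "pos_semidef n (1\<^sub>m n)"
  unfolding pos_semidef_def by (auto simp: cscalar_prod_self intro: sum_nonneg)

lemma pos_semidef_gram:
  assumes "Y \<in> carrier_mat n k"
  shows "pos_semidef k (adj Y * Y)"
  using pos_semidef_congruence[OF pos_semidef_one assms] assms by simp

lemma gram_form:
  assumes "Y \<in> carrier_mat n k" "v \<in> carrier_vec k"
  shows "(adj Y * Y *\<^sub>v v) \<bullet>c v = (Y *\<^sub>v v) \<bullet>c (Y *\<^sub>v v)"
  using congruence_form[of "1\<^sub>m n" n Y k v] assms by simp

text \<open>The vector is a unit eigenvector, taken as a block of width one at offset
  \<open>t - 1\<close>. It transfers sign conditions on the form to eigenvalues.\<close>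

lemma eigval_attained:
  assumes X: "X \<in> carrier_mat n n" "adj X = X" and t: "1 \<le> t" "t \<le> n"
  obtains w where "w \<in> carrier_vec n" "w \<bullet>c w = 1" "Re ((X *\<^sub>v w) \<bullet>c w) = eigval t X"
proof -
  obtain U where D: "eigen_decomp n U (\<lambda>j. eigval (Suc j) X) X" by (rule hermitian_spectral[OF X])
  define v where "v = (unit_vec 1 0 :: complex vec)"
  define w where "w = column_block U (t - 1) 1 *\<^sub>v v"
  have v: "v \<in> carrier_vec 1" by (simp add: v_def)
  have lt: "t - 1 + 1 \<le> n" using t by simp
  have "w \<in> carrier_vec n"
    unfolding w_def by (rule mult_mat_vec_carrier[OF column_block_carrier[OF eigen_decompD(1)[OF D]] v])
  moreover have "w \<bullet>c w = 1"
    unfolding w_def column_block_form(1)[OF D lt v] by (simp add: v_def scalar_prod_def)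
  moreover have "Re ((X *\<^sub>v w) \<bullet>c w) = eigval t X"
    unfolding w_def column_block_form(2)[OF D lt v] using t by (simp add: v_def)
  ultimately show ?thesis by (rule that)
qed

lemma nonzero_of_cscalar_prod_one: "(w :: complex vec) \<bullet>c w = 1 \<Longrightarrow> w \<noteq> 0\<^sub>v n"
  by auto

lemma eigval_nonneg:
  assumes "pos_semidef n M" "1 \<le> t" "t \<le> n"
  shows "0 \<le> eigval t M"
  by (rule eigval_attained[OF pos_semidefD(1,2)[OF assms(1)] assms(2,3)])
    (metis pos_semidefD(3)[OF assms(1)])

lemma eigval_pos:
  assumes M: "pos_def M" "M \<in> carrier_mat n n" and t: "1 \<le> t" "t \<le> n"
  shows "0 < eigval t M"
  by (rule eigval_attained[OF M(2) pos_defD(1)[OF M] t])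
    (metis pos_defD(2)[OF M] nonzero_of_cscalar_prod_one)

section \<open>Determinants as products of eigenvalues\<close>

lemma det_hermitian:
  assumes "X \<in> carrier_mat n n" "adj X = X"
  shows "det X = complex_of_real (\<Prod>t=1..n. eigval t X)"
proof -
  obtain U where D: "eigen_decomp n U (\<lambda>j. eigval (Suc j) X) X" by (rule hermitian_spectral[OF assms])
  have "(\<Prod>t=1..n. eigval t X) = (\<Prod>j<n. eigval (Suc j) X)"
    by (rule prod.reindex_bij_witness[of _ Suc "\<lambda>t. t - 1"]) auto
  then show ?thesis using det_eigen_decomp[OF D] by simp
qed

lemma Re_det_hermitian:
  assumes "X \<in> carrier_mat n n" "adj X = X"
  shows "Re (det X) = (\<Prod>t=1..n. eigval t X)"
  by (simp only: det_hermitian[OF assms] Re_complex_of_real)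

lemma det_pos_semidef_nonneg:
  assumes "pos_semidef n M"
  shows "0 \<le> Re (det M)"
  unfolding Re_det_hermitian[OF pos_semidefD(1,2)[OF assms]]
  by (rule prod_nonneg) (use eigval_nonneg[OF assms] in auto)

lemma det_pos_def_pos:
  assumes "pos_def M" "M \<in> carrier_mat n n"
  shows "0 < Re (det M)"
  unfolding Re_det_hermitian[OF assms(2) pos_defD(1)[OF assms]]
  by (rule prod_pos) (use eigval_pos[OF assms] in auto)

text \<open>Interlacing holds factor by factor, and the factors are nonnegative, so the inequalities
  multiply.\<close>

lemma det_compression_le:
  assumes K: "pos_semidef n K" and Q: "Q \<in> carrier_mat n k" "adj Q * Q = 1\<^sub>m k" and kn: "k \<le> n"
  shows "Re (det (adj Q * K * Q)) \<le> (\<Prod>t=1..k. eigval t K)"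
proof -
  note P = pos_semidef_congruence[OF K Q(1)]
  have "Re (det (adj Q * K * Q)) = (\<Prod>t=1..k. eigval t (adj Q * K * Q))"
    by (simp only: Re_det_hermitian[OF pos_semidefD(1,2)[OF P]])
  also have "\<dots> \<le> (\<Prod>t=1..k. eigval t K)"
    using eigval_compression_le[OF pos_semidefD(1,2)[OF K] Q] eigval_nonneg[OF P] kn
    by (intro prod_mono) auto
  finally show ?thesis .
qed

lemma det_compression_ge:
  assumes K: "pos_semidef n K" and Q: "Q \<in> carrier_mat n k" "adj Q * Q = 1\<^sub>m k" and kn: "k \<le> n"
  shows "(\<Prod>t=1..k. eigval (n - k + t) K) \<le> Re (det (adj Q * K * Q))"
proof -
  note P = pos_semidef_congruence[OF K Q(1)]
  have "(\<Prod>t=1..k. eigval (n - k + t) K) \<le> (\<Prod>t=1..k. eigval t (adj Q * K * Q))"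
    using eigval_compression_ge[OF pos_semidefD(1,2)[OF K] Q] eigval_nonneg[OF K] kn
    by (intro prod_mono) auto
  also have "\<dots> = Re (det (adj Q * K * Q))"
    by (simp only: Re_det_hermitian[OF pos_semidefD(1,2)[OF P]])
  finally show ?thesis .
qed

section \<open>Determinants under congruence and addition\<close>

lemma det_congruence:
  assumes "X \<in> carrier_mat k k" "R \<in> carrier_mat k k"
  shows "Re (det (adj R * X * R)) = (cmod (det R))\<^sup>2 * Re (det X)"
proof -
  have "det (adj R * X * R) = (det R * cnj (det R)) * det X"
    using assms det_mult[of "adj R * X" k R] det_mult[of "adj R" k X]
      mult_carrier_mat[OF adj_carrier[OF assms(2)] assms(1)]
    by (simp add: adj_carrier det_adj mult_ac)
  then show ?thesis by (simp add: complex_norm_square[symmetric] del: of_real_power)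
qed

text \<open>Scale the eigenvectors: \<open>R\<close> is \<open>U\<close> times the diagonal matrix
  of inverse square roots of the eigenvalues.\<close>

lemma pos_def_congruent_one:
  assumes P: "pos_def P" "P \<in> carrier_mat k k"
  obtains R where "R \<in> carrier_mat k k" "adj R * P * R = 1\<^sub>m k"
proof -
  obtain U where D: "eigen_decomp k U (\<lambda>j. eigval (Suc j) P) P"
    by (rule hermitian_spectral[OF P(2) pos_defD(1)[OF P]])
  define e where "e j = complex_of_real (1 / sqrt (eigval (Suc j) P))" for j
  define E where "E = mat_diag k e"
  let ?D = "mat_diag k (\<lambda>j. complex_of_real (eigval (Suc j) P))"
  note U = eigen_decompD(1)[OF D]
  have adjE: "adj E = E"
    by (rule eq_matI) (auto simp: E_def mat_diag_def e_def)
  have E: "E \<in> carrier_mat k k" by (simp add: E_def)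
  define R where "R = U * E"
  have R: "R \<in> carrier_mat k k" using U E by (simp add: R_def)
  have "adj R * P * R = E * ((adj U * U) * ?D * (adj U * U)) * E"
    unfolding R_def using U E by (subst eigen_decompD(4)[OF D]) (simp add: adj_mult adjE mult_assoc_dim)
  also have "\<dots> = E * ?D * E" using U E by (simp add: eigen_decompD(2)[OF D] mult_assoc_dim)
  also have "\<dots> = mat_diag k (\<lambda>j. e j * complex_of_real (eigval (Suc j) P) * e j)"
    by (simp add: E_def)
  also have "\<dots> = 1\<^sub>m k"
  proof (rule eq_matI)
    fix i j assume "i < dim_row (1\<^sub>m k :: complex mat)" "j < dim_col (1\<^sub>m k :: complex mat)"
    then have ij: "i < k" "j < k" by auto
    have pos: "0 < eigval (Suc j) P" using eigval_pos[OF P, of "Suc j"] ij by simp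
    define s where "s = sqrt (eigval (Suc j) P)"
    have s: "s * s = eigval (Suc j) P" "s \<noteq> 0" using pos by (simp_all add: s_def)
    have "e j * complex_of_real (eigval (Suc j) P) * e j = complex_of_real (1 / s * (s * s) * (1 / s))"
      by (simp only: e_def s_def[symmetric] s(1) of_real_mult)
    also have "\<dots> = 1" using s(2) by simp
    finally show "mat_diag k (\<lambda>j. e j * complex_of_real (eigval (Suc j) P) * e j) $$ (i,j) = 1\<^sub>m k $$ (i,j)"
      using ij by (simp add: mat_diag_def)
  qed (auto simp: mat_diag_def)
  finally show ?thesis using that[OF R] by simp
qed

text \<open>A QR factorization in disguise: with \<open>R\<close> reducing \<open>adj Y * Y\<close>
  to the identity, \<open>Q = Y * R\<close> is an isometry, and the squared modulus of
  \<open>det R\<close> is the reciprocal of \<open>det (adj Y * Y)\<close>.\<close>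

lemma det_gram_factor:
  assumes K: "K \<in> carrier_mat n n" and Y: "Y \<in> carrier_mat n k" and P: "pos_def (adj Y * Y)"
  obtains Q where "Q \<in> carrier_mat n k" "adj Q * Q = 1\<^sub>m k"
    "Re (det (adj Y * K * Y)) = Re (det (adj Y * Y)) * Re (det (adj Q * K * Q))"
proof -
  have Pc: "adj Y * Y \<in> carrier_mat k k" using Y by (intro carrier_matI) auto
  obtain R where R: "R \<in> carrier_mat k k" and RP: "adj R * (adj Y * Y) * R = 1\<^sub>m k"
    by (rule pos_def_congruent_one[OF P Pc])
  have Q: "Y * R \<in> carrier_mat n k" using Y R by simp
  have "adj (Y * R) * (Y * R) = adj R * (adj Y * Y) * R"
    using Y R by (simp add: adj_mult mult_assoc_dim)
  then have QQ: "adj (Y * R) * (Y * R) = 1\<^sub>m k" using RP by simp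
  have "adj (Y * R) * K * (Y * R) = adj R * (adj Y * K * Y) * R"
    using Y R K by (simp add: adj_mult mult_assoc_dim)
  then have 1: "Re (det (adj (Y * R) * K * (Y * R))) = (cmod (det R))\<^sup>2 * Re (det (adj Y * K * Y))"
    using det_congruence[OF carrier_matI R, of "adj Y * K * Y"] Y K by simp
  have "(cmod (det R))\<^sup>2 * Re (det (adj Y * Y)) = 1"
    using det_congruence[OF Pc R] RP by simp
  then have "Re (det (adj Y * K * Y)) = Re (det (adj Y * Y)) * Re (det (adj (Y * R) * K * (Y * R)))"
    unfolding 1 by (simp add: mult_ac)
  with Q QQ show ?thesis by (rule that)
qed

lemma det_congruence_le:
  assumes K: "pos_semidef n K" and Y: "Y \<in> carrier_mat n k" and P: "pos_def (adj Y * Y)" and kn: "k \<le> n"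
  shows "Re (det (adj Y * K * Y)) \<le> Re (det (adj Y * Y)) * (\<Prod>t=1..k. eigval t K)"
proof -
  obtain Q where Q: "Q \<in> carrier_mat n k" "adj Q * Q = 1\<^sub>m k"
    and eq: "Re (det (adj Y * K * Y)) = Re (det (adj Y * Y)) * Re (det (adj Q * K * Q))"
    by (rule det_gram_factor[OF pos_semidefD(1)[OF K] Y P])
  show ?thesis
    unfolding eq using det_compression_le[OF K Q kn] det_pos_semidef_nonneg[OF pos_semidef_gram[OF Y]]
    by (rule mult_left_mono)
qed

text \<open>\<open>Y\<close> may have dependent columns here, because it will be
  \<open>(A - B) * V\<close> and \<open>A - B\<close> may be singular; that case is handled
  separately.\<close>

lemma det_congruence_ge:
  assumes K: "pos_semidef n K" and Y: "Y \<in> carrier_mat n k" and kn: "k \<le> n"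
  shows "Re (det (adj Y * Y)) * (\<Prod>t=1..k. eigval (n - k + t) K) \<le> Re (det (adj Y * K * Y))"
proof (cases "pos_def (adj Y * Y)")
  case True
  obtain Q where Q: "Q \<in> carrier_mat n k" "adj Q * Q = 1\<^sub>m k"
    and eq: "Re (det (adj Y * K * Y)) = Re (det (adj Y * Y)) * Re (det (adj Q * K * Q))"
    by (rule det_gram_factor[OF pos_semidefD(1)[OF K] Y True])
  show ?thesis
    unfolding eq using det_compression_ge[OF K Q kn] det_pos_semidef_nonneg[OF pos_semidef_gram[OF Y]]
    by (rule mult_left_mono)
next
  case False
  note G = pos_semidef_gram[OF Y]
  have Gc: "adj Y * Y \<in> carrier_mat k k" by (rule pos_semidefD(1)[OF G])
  \<comment> \<open>Failure of definiteness gives a nonzero \<open>v\<close> with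
    \<open>Y *\<^sub>v v = 0\<close>. The Gram determinant then vanishes and only nonnegativity of
    the right-hand side remains.\<close>
  obtain v where v: "v \<in> carrier_vec k" "v \<noteq> 0\<^sub>v k" and le: "\<not> 0 < Re ((adj Y * Y *\<^sub>v v) \<bullet>c v)"
    using False pos_defI[OF Gc pos_semidefD(2)[OF G]] by blast
  have Yv: "Y *\<^sub>v v \<in> carrier_vec n" by (rule mult_mat_vec_carrier[OF Y v(1)])
  have "Y *\<^sub>v v = 0\<^sub>v n"
    using cscalar_prod_self_pos[OF Yv] le unfolding gram_form[OF Y v(1)] by blast
  then have "adj Y * Y *\<^sub>v v = 0\<^sub>v k"
    using Y v(1) by (simp add: mult_mat_vec_assoc_dim) (rule eq_vecI, auto simp: scalar_prod_def)
  then have "det (adj Y * Y) = 0"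
    using det_0_iff_vec_prod_zero_field[OF Gc] v by blast
  then show ?thesis using det_pos_semidef_nonneg[OF pos_semidef_congruence[OF K Y]] by simp
qed

text \<open>Expanding the product and pairing every subset with its complement gives the
  coefficient \<open>2\<^sup>k - 2\<close>; the induction below is the same argument.\<close>

lemma prod_one_plus_ge:
  fixes \<mu> :: "'a \<Rightarrow> real"
  assumes "finite S" "\<And>t. t \<in> S \<Longrightarrow> 0 \<le> \<mu> t"
  shows "1 + (\<Prod>t\<in>S. \<mu> t) + (2 ^ card S - 2) * sqrt (\<Prod>t\<in>S. \<mu> t) \<le> (\<Prod>t\<in>S. 1 + \<mu> t)"
  using assms
proof (induction S rule: finite_induct)
  case (insert x S)
  define p where "p = (\<Prod>t\<in>S. \<mu> t)"
  have p: "0 \<le> p" and x: "0 \<le> \<mu> x" using insert.prems by (auto simp: p_def intro: prod_nonneg)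
  \<comment> \<open>Passing to square roots makes the claim polynomial in \<open>a\<close> and
    \<open>b\<close>.\<close>
  define a where "a = sqrt p"
  define b where "b = sqrt (\<mu> x)"
  have ab: "p = a * a" "\<mu> x = b * b" "0 \<le> a" "0 \<le> b" "sqrt (\<mu> x * p) = b * a"
    using p x by (simp_all add: a_def b_def real_sqrt_mult)
  have IH: "1 + p + (2 ^ card S - 2) * a \<le> (\<Prod>t\<in>S. 1 + \<mu> t)"
    using insert by (simp add: p_def a_def)
  show ?case
  \<comment> \<open>For empty \<open>S\<close> the new set is a singleton, the coefficient is 0 and
    equality holds. Otherwise \<open>2 ^ card S - 2\<close> is nonnegative, and the bounds
    \<open>2ab \<le> a^2 + b^2\<close> and \<open>2b \<le> 1 + b^2\<close> suffice.\<close>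
  proof (cases "S = {}")
    case False
    then have "card S \<ge> 1" using insert.hyps(1) by (simp add: Suc_leI card_gt_0_iff)
    then have c: "(2::real) ^ card S \<ge> 2" using power_increasing[of 1 "card S" "2::real"] by simp
    have "2 * (a * b) \<le> a * a + b * b" using sum_squares_bound[of a b] by (simp add: power2_eq_square)
    moreover have "((2::real) ^ card S - 2) * a * (2 * b) \<le> (2 ^ card S - 2) * a * (1 + b * b)"
      using sum_squares_bound[of 1 b] c ab(3)
      by (intro mult_left_mono mult_nonneg_nonneg) (auto simp: power2_eq_square)
    ultimately have "1 + b * b * (a * a) + (2 * 2 ^ card S - 2) * (b * a)
        \<le> (1 + b * b) * (1 + a * a + (2 ^ card S - 2) * a)"
      by (simp add: algebra_simps)
    also have "\<dots> \<le> (1 + b * b) * (\<Prod>t\<in>S. 1 + \<mu> t)"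
      using IH ab by (intro mult_left_mono) auto
    finally show ?thesis
      using insert.hyps ab by (simp add: p_def[symmetric])
  qed simp
qed simp

text \<open>A congruence by \<open>R\<close> takes \<open>P\<close> to the identity and
  \<open>Q\<close> to \<open>S\<close>. The determinant of \<open>I + S\<close> is the product of
  one plus the eigenvalues of \<open>S\<close>, and all determinants scale by the same factor
  \<open>\<rho>\<close>.\<close>

lemma det_add_ge:
  assumes P: "pos_def P" "P \<in> carrier_mat k k" and Q: "pos_semidef k Q"
  shows "Re (det P) + Re (det Q) + (2 ^ k - 2) * sqrt (Re (det P) * Re (det Q)) \<le> Re (det (P + Q))"
proof -
  note Qc = pos_semidefD(1)[OF Q]
  obtain R where R: "R \<in> carrier_mat k k" and RP: "adj R * P * R = 1\<^sub>m k"
    by (rule pos_def_congruent_one[OF P])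
  define S where "S = adj R * Q * R"
  have psd: "pos_semidef k S" unfolding S_def by (rule pos_semidef_congruence[OF Q R])
  note S = pos_semidefD(1,2)[OF psd]
  define \<rho> where "\<rho> = (cmod (det R))\<^sup>2"
  define m where "m = (\<Prod>t=1..k. eigval t S)"
  obtain U where D: "eigen_decomp k U (\<lambda>j. eigval (Suc j) S) S" by (rule hermitian_spectral[OF S])
  have "eigen_decomp k U (\<lambda>j. 1 + eigval (Suc j) S) (1\<^sub>m k + S)"
  proof (rule eigen_decompI)
    fix j assume j: "j < k"
    show "(1\<^sub>m k + S) *\<^sub>v col U j = complex_of_real (1 + eigval (Suc j) S) \<cdot>\<^sub>v col U j"
      using S eigen_decompD(1)[OF D] eigen_decomp_col[OF D j]
      by (auto simp: add_mult_distrib_mat_vec[of _ k k] add_smult_distrib_vec)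
  qed (use S eigen_decompD[OF D] in auto)
  then have "det (1\<^sub>m k + S) = complex_of_real (\<Prod>j<k. 1 + eigval (Suc j) S)" by (rule det_eigen_decomp)
  also have "(\<Prod>j<k. 1 + eigval (Suc j) S) = (\<Prod>t=1..k. 1 + eigval t S)"
    by (rule prod.reindex_bij_witness[of _ "\<lambda>t. t - 1" Suc]) auto
  finally have "Re (det (1\<^sub>m k + S)) = (\<Prod>t=1..k. 1 + eigval t S)"
    by (simp only: Re_complex_of_real)
  also have "1\<^sub>m k + S = adj R * (P + Q) * R"
    unfolding RP[symmetric] S_def using R P(2) Qc
      mult_add_distrib_mat[of "adj R" k k P k Q] add_mult_distrib_mat[of "adj R * P" k k "adj R * Q" R k]
      mult_carrier_mat[OF adj_carrier[OF R] P(2)] mult_carrier_mat[OF adj_carrier[OF R] Qc]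
    by (simp add: adj_carrier)
  finally have "\<rho> * Re (det (P + Q)) = (\<Prod>t=1..k. 1 + eigval t S)"
    using det_congruence[of "P + Q" k R] P(2) Qc R by (simp add: \<rho>_def)
  moreover have "1 + m + (2 ^ k - 2) * sqrt m \<le> (\<Prod>t=1..k. 1 + eigval t S)"
    using prod_one_plus_ge[of "{1..k}" "\<lambda>t. eigval t S"] eigval_nonneg[OF psd] by (simp add: m_def)
  ultimately have main: "1 + m + (2 ^ k - 2) * sqrt m \<le> \<rho> * Re (det (P + Q))" by simp
  have \<rho>P: "\<rho> * Re (det P) = 1"
    using det_congruence[OF P(2) R] RP by (simp add: \<rho>_def)
  have \<rho>Q: "\<rho> * Re (det Q) = m"
    unfolding \<rho>_def m_def Re_det_hermitian[OF S, symmetric] unfolding S_def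
    by (rule det_congruence[OF Qc R, symmetric])
  define a where "a = Re (det P)"
  have a: "0 < a" unfolding a_def by (rule det_pos_def_pos[OF P])
  \<comment> \<open>\<open>a = det P\<close> is the reciprocal of \<open>\<rho>\<close>, so
    multiplying by it undoes the congruence.\<close>
  have inv: "x = a * (\<rho> * x)" for x using \<rho>P by (simp add: a_def mult_ac)
  have b: "Re (det Q) = a * m" using inv[of "Re (det Q)"] \<rho>Q by simp
  have "a * Re (det Q) = a\<^sup>2 * m" by (simp add: b power2_eq_square)
  then have "sqrt (a * Re (det Q)) = a * sqrt m" using a by (simp add: real_sqrt_mult)
  then have "a + Re (det Q) + (2 ^ k - 2) * sqrt (a * Re (det Q)) = a * (1 + m + (2 ^ k - 2) * sqrt m)"
    by (simp add: b algebra_simps)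
  also have "\<dots> \<le> a * (\<rho> * Re (det (P + Q)))" using main a by (intro mult_left_mono) auto
  also have "\<dots> = Re (det (P + Q))" using inv by simp
  finally show ?thesis by (simp add: a_def)
qed

section \<open>Hua's identity\<close>

text \<open>A right inverse of a square matrix is two-sided, so \<open>mat_inverse\<close> succeeds,
  and uniqueness of inverses identifies its value.\<close>

lemma inv_mat_eqI:
  assumes X: "X \<in> carrier_mat n n" and B: "B \<in> carrier_mat n n" and XB: "X * B = 1\<^sub>m n"
  shows "inv_mat X = B"
proof -
  have BX: "B * X = 1\<^sub>m n" by (rule mat_mult_left_right_inverse[OF X B XB])
  have "X \<in> Units (ring_mat TYPE(complex) n ())"
    using X B XB BX by (auto simp: Units_def ring_mat_simps)
  then obtain C where C: "mat_inverse X = Some C" using mat_inverse(1)[OF X, of "()"] by (cases "mat_inverse X") auto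
  then have "C * X = 1\<^sub>m n" and Cc: "C \<in> carrier_mat n n" using mat_inverse(2)[OF X C] by auto
  have "C = C * (X * B)" using Cc XB by simp
  also have "\<dots> = (C * X) * B" using Cc X B by (simp add: mult_assoc_dim)
  also have "\<dots> = B" using B \<open>C * X = 1\<^sub>m n\<close> by simp
  finally show ?thesis using C by (simp add: inv_mat_def)
qed

lemma eigen_decomp_one_minus:
  assumes D: "eigen_decomp n U d X"
  shows "eigen_decomp n U (\<lambda>j. 1 - d j) (1\<^sub>m n - X)"
proof (rule eigen_decompI)
  note X = eigen_decompD(5)[OF D] and U = eigen_decompD(1)[OF D]
  fix j assume j: "j < n"
  have "(1\<^sub>m n - X) *\<^sub>v col U j = col U j - X *\<^sub>v col U j"
    using X U j minus_mult_distrib_mat_vec[of "1\<^sub>m n" n n X "col U j"] by simp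
  also have "\<dots> = complex_of_real (1 - d j) \<cdot>\<^sub>v col U j"
    unfolding eigen_decomp_col[OF D j] using U by (intro eq_vecI) (auto simp: algebra_simps)
  finally show "(1\<^sub>m n - X) *\<^sub>v col U j = complex_of_real (1 - d j) \<cdot>\<^sub>v col U j" .
qed (use eigen_decompD(1,2,5)[OF D] in auto)

lemma eigen_decomp_mult:
  assumes D: "eigen_decomp n U d X" and E: "eigen_decomp n U e Y"
  shows "X * Y = U * mat_diag n (\<lambda>i. complex_of_real (d i * e i)) * adj U"
proof -
  let ?D = "mat_diag n (\<lambda>i. complex_of_real (d i))" and ?E = "mat_diag n (\<lambda>i. complex_of_real (e i))"
  note U = eigen_decompD(1)[OF D]
  have "X * Y = (U * ?D * adj U) * (U * ?E * adj U)"
    by (simp only: eigen_decompD(4)[OF D, symmetric] eigen_decompD(4)[OF E, symmetric])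
  also have "\<dots> = U * (?D * (adj U * U) * ?E) * adj U" using U by (simp add: mult_assoc_dim)
  also have "?D * (adj U * U) * ?E = mat_diag n (\<lambda>i. complex_of_real (d i * e i))"
    by (simp add: eigen_decompD(2)[OF D])
  finally show ?thesis .
qed

lemma eigen_decomp_hermitian:
  assumes D: "eigen_decomp n U d X"
  shows "adj X = X"
proof -
  let ?D = "mat_diag n (\<lambda>i. complex_of_real (d i))"
  have "adj ?D = ?D" by (rule eq_matI) (auto simp: mat_diag_def)
  then have "adj (U * ?D * adj U) = U * ?D * adj U"
    using eigen_decompD(1)[OF D] by (simp add: adj_mult mult_assoc_dim)
  then show ?thesis by (simp only: eigen_decompD(4)[OF D, symmetric])
qed

text \<open>The map \<open>x \<mapsto> 1 - x\<close> reverses the order of the eigenvalues; the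
  reindexing \<open>n - 1 - j\<close> restores a decreasing list.\<close>

lemma eigval_one_minus:
  assumes X: "X \<in> carrier_mat n n" "adj X = X" and t: "1 \<le> t" "t \<le> n"
  shows "eigval t (1\<^sub>m n - X) = 1 - eigval (n - t + 1) X"
proof -
  obtain U where D: "eigen_decomp n U (\<lambda>j. eigval (Suc j) X) X" by (rule hermitian_spectral[OF X])
  have "bij_betw (\<lambda>j. n - 1 - j) {..<n} {..<n}"
    by (rule bij_betw_byWitness[where f' = "\<lambda>j. n - 1 - j"]) auto
  from eigen_decomp_reindex[OF eigen_decomp_one_minus[OF D] this]
  obtain U' where D': "eigen_decomp n U' (\<lambda>j. 1 - eigval (Suc (n - 1 - j)) X) (1\<^sub>m n - X)" by blast
  have "eigval t (1\<^sub>m n - X) = 1 - eigval (Suc (n - 1 - (t - 1))) X"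
    by (rule eigval_eigen_decomp[OF D' _ t]) (use eigval_antimono[OF X(1)] in auto)
  also have "Suc (n - 1 - (t - 1)) = n - t + 1" using t by simp
  finally show ?thesis .
qed

lemma add_mult_distrib_dim:
  fixes A B C :: "'a :: semiring_0 mat"
  shows "dim_row A = dim_row B \<Longrightarrow> dim_col A = dim_col B \<Longrightarrow> dim_col B = dim_row C \<Longrightarrow> (A + B) * C = A * C + B * C"
  by (rule add_mult_distrib_mat) auto

lemma mult_add_distrib_dim:
  fixes A B C :: "'a :: semiring_0 mat"
  shows "dim_col A = dim_row B \<Longrightarrow> dim_row B = dim_row C \<Longrightarrow> dim_col B = dim_col C \<Longrightarrow> A * (B + C) = A * B + A * C"
  by (rule mult_add_distrib_mat) auto

lemma minus_mult_distrib_dim: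
  fixes A B C :: "'a :: ring mat"
  shows "dim_row A = dim_row B \<Longrightarrow> dim_col A = dim_col B \<Longrightarrow> dim_col B = dim_row C \<Longrightarrow> (A - B) * C = A * C - B * C"
  by (rule minus_mult_distrib_mat) auto

lemma mult_minus_distrib_dim:
  fixes A B C :: "'a :: ring mat"
  shows "dim_col A = dim_row B \<Longrightarrow> dim_row B = dim_row C \<Longrightarrow> dim_col B = dim_col C \<Longrightarrow> A * (B - C) = A * B - A * C"
  by (rule mult_minus_distrib_mat) auto

lemmas mat_distribs_dim = add_mult_distrib_dim mult_add_distrib_dim minus_mult_distrib_dim
  mult_minus_distrib_dim mult_assoc_dim

section \<open>The resolvents \<open>G\<close> and \<open>K\<close> and Hua's identity\<close>

context
  fixes n :: nat and A G K :: "complex mat"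
  assumes A: "A \<in> carrier_mat n n" and G: "G \<in> carrier_mat n n"
    and G_left: "G * (1\<^sub>m n - adj A * A) = 1\<^sub>m n" and G_right: "(1\<^sub>m n - adj A * A) * G = 1\<^sub>m n"
    and K_def: "K = 1\<^sub>m n + A * G * adj A"
begin

lemma mult_G: "adj A * (A * G) = G - 1\<^sub>m n"
proof -
  have "G - adj A * (A * G) = 1\<^sub>m n"
    using G_right A G by (simp add: mat_distribs_dim)
  then have "G - (G - adj A * (A * G)) = G - 1\<^sub>m n" by simp
  \<comment> \<open>Products are kept opaque, so comparing entries leaves only additive
    arithmetic.\<close>
  moreover have "G - (G - adj A * (A * G)) = adj A * (A * G)"
    using A G by (intro eq_matI) (auto simp del: index_mult_mat(1))
  ultimately show ?thesis by simp
qed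

lemma G_mult: "G * (adj A * A) = G - 1\<^sub>m n"
proof -
  have "G - G * (adj A * A) = 1\<^sub>m n"
    using G_left A G by (simp add: mat_distribs_dim)
  then have "G - (G - G * (adj A * A)) = G - 1\<^sub>m n" by simp
  moreover have "G - (G - G * (adj A * A)) = G * (adj A * A)"
    using A G by (intro eq_matI) (auto simp del: index_mult_mat(1))
  ultimately show ?thesis by simp
qed

lemma K_carrier: "K \<in> carrier_mat n n"
  unfolding K_def using A G by (intro carrier_matI) auto

text \<open>A push-through identity: moving \<open>A\<close> past the resolvent turns
  \<open>K\<close> into \<open>G\<close>, because \<open>G * (adj A * A) = G - I\<close>.\<close>

lemma K_mult_A: "K * A = A * G"
proof -
  have "K * A = A + A * (G * (adj A * A))"
    unfolding K_def using A G by (simp add: mat_distribs_dim)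
  also have "\<dots> = A + (A * G - A)"
    unfolding G_mult using A G by (simp add: mat_distribs_dim)
  also have "\<dots> = A * G" using A G by (intro eq_matI) (auto simp del: index_mult_mat(1))
  finally show ?thesis .
qed

lemma adj_A_mult_K: "adj A * K = G * adj A"
proof -
  have "adj A * K = adj A + adj A * (A * G) * adj A"
    unfolding K_def using A G by (simp add: mat_distribs_dim)
  also have "\<dots> = adj A + (G * adj A - adj A)"
    unfolding mult_G using A G by (simp add: mat_distribs_dim)
  also have "\<dots> = G * adj A" using A G by (intro eq_matI) (auto simp del: index_mult_mat(1))
  finally show ?thesis .
qed

text \<open>The formula for \<open>K\<close> is the Woodbury identity for the inverse of
  \<open>I - A * adj A\<close>; push-through verifies it.\<close>

lemma K_right: "(1\<^sub>m n - A * adj A) * K = 1\<^sub>m n"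
proof -
  have "(1\<^sub>m n - A * adj A) * K = K - A * (adj A * K)"
    using A K_carrier by (simp add: mat_distribs_dim)
  also have "\<dots> = K - A * G * adj A" using A G by (simp add: adj_A_mult_K mult_assoc_dim)
  also have "\<dots> = 1\<^sub>m n"
    unfolding K_def using A G by (intro eq_matI) (auto simp del: index_mult_mat(1))
  finally show ?thesis .
qed

text \<open>Expand both sides. Push-through removes \<open>K\<close> wherever it stands next to
  \<open>A\<close> or \<open>adj A\<close>; in the remaining term \<open>adj B * K * B\<close> its
  formula is inserted, which supplies the \<open>adj B * B\<close> that cancels.\<close>

lemma hua_identity:
  assumes B: "B \<in> carrier_mat n n"
  shows "adj (1\<^sub>m n - adj A * B) * G * (1\<^sub>m n - adj A * B)
    = (1\<^sub>m n - adj B * B) + adj (A - B) * K * (A - B)"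
proof -
  have K: "K \<in> carrier_mat n n" by (rule K_carrier)
  have AKB: "adj A * (K * B) = G * (adj A * B)"
    using A B G K by (simp add: mult_assoc_dim[symmetric] adj_A_mult_K)
  have BKB: "adj B * (K * B) = adj B * B + adj B * (A * (G * (adj A * B)))"
    unfolding K_def using A B G by (simp add: mat_distribs_dim)
  have H: "adj (A - B) * K * (A - B) = (G - 1\<^sub>m n - adj B * (A * G)) -
      (G * (adj A * B) - (adj B * B + adj B * (A * (G * (adj A * B)))))"
    using A B G K by (simp add: adj_minus mat_distribs_dim AKB BKB K_mult_A mult_G)
  have C: "adj (1\<^sub>m n - adj A * B) * G * (1\<^sub>m n - adj A * B) =
      G - adj B * (A * G) - (G * (adj A * B) - adj B * (A * (G * (adj A * B))))"
    using A B G by (simp add: adj_minus adj_mult mat_distribs_dim)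
  show ?thesis
    unfolding H C using A B G by (intro eq_matI) (auto simp del: index_mult_mat(1))
qed

end

section \<open>The inequality\<close>

text \<open>Functional calculus: \<open>G\<close> keeps the eigenvectors of \<open>adj A * A\<close>
  and applies \<open>1 / (1 - x)\<close> to the eigenvalues, which stay below 1.\<close>

lemma resolvent_exists:
  assumes A: "A \<in> carrier_mat n n" and lt: "\<And>t. 1 \<le> t \<Longrightarrow> t \<le> n \<Longrightarrow> eigval t (adj A * A) < 1"
    and D: "eigen_decomp n U (\<lambda>j. eigval (Suc j) (adj A * A)) (adj A * A)"
  obtains G where "eigen_decomp n U (\<lambda>j. 1 / (1 - eigval (Suc j) (adj A * A))) G"
    "G * (1\<^sub>m n - adj A * A) = 1\<^sub>m n" "(1\<^sub>m n - adj A * A) * G = 1\<^sub>m n"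
proof -
  let ?d = "\<lambda>j. eigval (Suc j) (adj A * A)"
  note U = eigen_decompD(1)[OF D]
  define G where "G = U * mat_diag n (\<lambda>i. complex_of_real (1 / (1 - ?d i))) * adj U"
  have DG: "eigen_decomp n U (\<lambda>j. 1 / (1 - ?d j)) G"
    using eigen_decompD[OF D] unfolding eigen_decomp_def G_def by blast
  have W: "1\<^sub>m n - adj A * A \<in> carrier_mat n n" using A by (intro carrier_matI) auto
  have G: "G \<in> carrier_mat n n" by (rule eigen_decompD(5)[OF DG])
  have "mat_diag n (\<lambda>j. complex_of_real (1 / (1 - ?d j) * (1 - ?d j))) = 1\<^sub>m n"
  proof (rule eq_matI)
    fix i j assume "i < dim_row (1\<^sub>m n :: complex mat)" "j < dim_col (1\<^sub>m n :: complex mat)"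
    then have ij: "i < n" "j < n" by auto
    then have "?d j < 1" using lt[of "Suc j"] by simp
    then have "1 / (1 - ?d j) * (1 - ?d j) = 1" by simp
    then have "complex_of_real (1 / (1 - ?d j) * (1 - ?d j)) = 1" by (simp only: of_real_1)
    then show "mat_diag n (\<lambda>j. complex_of_real (1 / (1 - ?d j) * (1 - ?d j))) $$ (i,j) = 1\<^sub>m n $$ (i,j)"
      using ij by (simp add: mat_diag_def del: times_divide_eq_left of_real_mult of_real_divide of_real_diff)
  qed auto
  then have "G * (1\<^sub>m n - adj A * A) = 1\<^sub>m n"
    using eigen_decomp_mult[OF DG eigen_decomp_one_minus[OF D]] U eigen_decompD(3)[OF D] by simp
  then show ?thesis using that[OF DG] mat_mult_left_right_inverse[OF G W] by blast
qed

text \<open>\<open>K\<close> acts on \<open>A x\<close> as \<open>(I - A\<^sup>*A)\<^sup>-\<^sup>1\<close> acts on \<open>x\<close>; testing \<open>K\<close> on the images under \<open>A\<close> of the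
  leading eigenvectors of \<open>A\<^sup>*A\<close> avoids comparing the spectra of \<open>A A\<^sup>*\<close> and \<open>A\<^sup>*A\<close>.\<close>

lemma eigval_dual_resolvent_ge:
  assumes A: "A \<in> carrier_mat n n" and lt: "\<And>t. 1 \<le> t \<Longrightarrow> t \<le> n \<Longrightarrow> eigval t (adj A * A) < 1"
    and D: "eigen_decomp n U (\<lambda>j. eigval (Suc j) (adj A * A)) (adj A * A)"
    and DG: "eigen_decomp n U (\<lambda>j. 1 / (1 - eigval (Suc j) (adj A * A))) G"
    and K: "pos_semidef n K" and AK: "adj A * K = G * adj A" and GA: "G * (adj A * A) = G - 1\<^sub>m n"
    and ge1: "\<And>w. w \<in> carrier_vec n \<Longrightarrow> Re (w \<bullet>c w) \<le> Re ((K *\<^sub>v w) \<bullet>c w)"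
    and t: "1 \<le> t" "t \<le> n"
  shows "1 / (1 - eigval t (adj A * A)) \<le> eigval t K"
proof -
  let ?P = "adj A * A"
  let ?d = "\<lambda>j. eigval (Suc j) ?P"
  have psd: "pos_semidef n ?P" by (rule pos_semidef_gram[OF A])
  note P = pos_semidefD(1)[OF psd] and G = eigen_decompD(5)[OF DG] and Kc = pos_semidefD(1,2)[OF K]
  show ?thesis
  proof (cases "eigval t ?P = 0")
    \<comment> \<open>With a zero eigenvalue \<open>A\<close> can kill some of the test vectors, but
      the claim reduces to \<open>1 \<le> eigval t K\<close>, which follows from
      \<open>K \<ge> I\<close>.\<close>
    case True
    have "1 \<le> eigval n K"
      by (rule eigval_ge_of_form[OF Kc, of "1\<^sub>m n"]) (use t ge1 in auto)
    also have "\<dots> \<le> eigval t K" by (rule eigval_antimono[OF Kc(1)]) (use t in auto)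
    finally show ?thesis using True by simp
  next
    case False
    then have pos: "0 < eigval t ?P" using eigval_nonneg[OF psd t] by simp
    define B where "B = column_block U 0 t"
    have B: "B \<in> carrier_mat n t" using eigen_decompD(1)[OF D] by (simp add: B_def)
    have lt0: "0 + t \<le> n" using t by simp
    have dge: "eigval t ?P \<le> ?d j" "?d j < 1" if "j < t" for j
      using eigval_antimono[OF P, of "Suc j" t] lt[of "Suc j"] that t by auto
    have eq: "A * B *\<^sub>v v = A *\<^sub>v (B *\<^sub>v v)" if "v \<in> carrier_vec t" for v
      using A B that by (simp add: mult_mat_vec_assoc_dim)
    have nrm: "Re ((A * B *\<^sub>v v) \<bullet>c (A * B *\<^sub>v v)) = (\<Sum>j<t. ?d j * (cmod (v $ j))\<^sup>2)"
      if v: "v \<in> carrier_vec t" for v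
    proof -
      have "(A * B *\<^sub>v v) \<bullet>c (A * B *\<^sub>v v) = (?P *\<^sub>v (B *\<^sub>v v)) \<bullet>c (B *\<^sub>v v)"
        unfolding eq[OF v] by (rule gram_form[OF A mult_mat_vec_carrier[OF B v], symmetric])
      then show ?thesis using column_block_form(2)[OF D lt0 v] by (simp add: B_def)
    qed
    \<comment> \<open>\<open>adj A * K * A = G - I\<close>, which is diagonal in the eigenbasis of
      \<open>adj A * A\<close>.\<close>
    have Kform: "Re ((K *\<^sub>v (A * B *\<^sub>v v)) \<bullet>c (A * B *\<^sub>v v))
        = (\<Sum>j<t. (1 / (1 - ?d j) - 1) * (cmod (v $ j))\<^sup>2)" if v: "v \<in> carrier_vec t" for v
    proof -
      define x where "x = B *\<^sub>v v"
      have x: "x \<in> carrier_vec n" unfolding x_def by (rule mult_mat_vec_carrier[OF B v])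
      have "(K *\<^sub>v (A *\<^sub>v x)) \<bullet>c (A *\<^sub>v x) = (adj A * K * A *\<^sub>v x) \<bullet>c x"
        by (rule congruence_form[OF Kc(1) A x, symmetric])
      also have "adj A * K * A = G - 1\<^sub>m n"
        using A G by (simp add: AK GA mult_assoc_dim)
      also have "(G - 1\<^sub>m n) *\<^sub>v x = G *\<^sub>v x - x"
        using G x by (simp add: minus_mult_distrib_mat_vec[of _ n n])
      also have "(G *\<^sub>v x - x) \<bullet>c x = (G *\<^sub>v x) \<bullet>c x - x \<bullet>c x"
        using mult_mat_vec_carrier[OF G x] x by (intro minus_scalar_prod_distrib[of _ n]) auto
      finally have "Re ((K *\<^sub>v (A *\<^sub>v x)) \<bullet>c (A *\<^sub>v x)) = Re ((G *\<^sub>v x) \<bullet>c x) - Re (x \<bullet>c x)"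
        by (simp only: minus_complex.sel)
      also have "Re ((G *\<^sub>v x) \<bullet>c x) = (\<Sum>j<t. 1 / (1 - ?d j) * (cmod (v $ j))\<^sup>2)"
        using column_block_form(2)[OF DG lt0 v] by (simp add: x_def B_def)
      also have "x \<bullet>c x = v \<bullet>c v"
        unfolding x_def B_def by (rule column_block_form(1)[OF D lt0 v])
      also have "Re (v \<bullet>c v) = (\<Sum>j<t. (cmod (v $ j))\<^sup>2)"
        unfolding cscalar_prod_self using v by (simp only: Re_complex_of_real carrier_vecD)
      finally show ?thesis
        unfolding eq[OF v] x_def by (simp only: sum_subtractf[symmetric] left_diff_distrib mult_1_left)
    qed
    show ?thesis
    proof (rule eigval_ge_of_form[OF Kc mult_carrier_mat[OF A B] t])
      fix v :: "complex vec" assume v: "v \<in> carrier_vec t"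
      show "A * B *\<^sub>v v \<noteq> 0\<^sub>v n" if "v \<noteq> 0\<^sub>v t"
      proof
        assume 0: "A * B *\<^sub>v v = 0\<^sub>v n"
        have "0 < eigval t ?P * Re (v \<bullet>c v)" using pos cscalar_prod_self_pos[OF v that] by simp
        also have "\<dots> = (\<Sum>j<t. eigval t ?P * (cmod (v $ j))\<^sup>2)"
          unfolding cscalar_prod_self using v by (simp only: Re_complex_of_real carrier_vecD sum_distrib_left)
        also have "\<dots> \<le> (\<Sum>j<t. ?d j * (cmod (v $ j))\<^sup>2)"
          using dge by (intro sum_mono mult_right_mono) auto
        also have "\<dots> = 0" unfolding nrm[OF v, symmetric] 0 by simp
        finally show False by simp
      qed
      \<comment> \<open>Coefficientwise comparison: \<open>1 / (1 - x) - 1 = x / (1 - x)\<close>,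
        and \<open>1 / (1 - x)\<close> is smallest at the last of the \<open>t\<close> leading
        eigenvalues.\<close>
      have "1 / (1 - eigval t ?P) * ?d j \<le> 1 / (1 - ?d j) - 1" if "j < t" for j
      proof -
        have "1 / (1 - eigval t ?P) \<le> 1 / (1 - ?d j)"
          using dge[OF that] by (intro divide_left_mono) auto
        then have "1 / (1 - eigval t ?P) * ?d j \<le> 1 / (1 - ?d j) * ?d j"
          using dge(1)[OF that] pos by (intro mult_right_mono) auto
        also have "\<dots> = 1 / (1 - ?d j) - 1" using dge(2)[OF that] by (simp add: field_simps)
        finally show ?thesis .
      qed
      then show "1 / (1 - eigval t ?P) * Re ((A * B *\<^sub>v v) \<bullet>c (A * B *\<^sub>v v))
          \<le> Re ((K *\<^sub>v (A * B *\<^sub>v v)) \<bullet>c (A * B *\<^sub>v v))"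
        unfolding nrm[OF v] Kform[OF v] sum_distrib_left mult.assoc[symmetric]
        by (intro sum_mono mult_right_mono) auto
    qed
  qed
qed

lemma prod_reverse_index:
  fixes f :: "nat \<Rightarrow> 'a :: comm_monoid_mult"
  assumes "k \<le> n"
  shows "(\<Prod>t=1..k. f (n - t + 1)) = (\<Prod>t=1..k. f (n - k + t))"
  by (rule prod.reindex_bij_witness[of _ "\<lambda>t. k + 1 - t" "\<lambda>t. k + 1 - t"]) (use assms in \<open>auto simp: Suc_diff_le\<close>)

text \<open>No sign condition arises: the real \<open>sqrt\<close> is extended as an odd function
  and is multiplicative everywhere. For infinite \<open>S\<close> both products are 1.\<close>

lemma sqrt_prod: "sqrt (\<Prod>t\<in>S. f t) = (\<Prod>t\<in>S. sqrt (f t))"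
  by (induction S rule: infinite_finite_induct) (auto simp: real_sqrt_mult)

lemma singval_sq:
  assumes X: "X \<in> carrier_mat n n" and t: "1 \<le> t" "t \<le> n"
  shows "(singval t X)\<^sup>2 = eigval t (adj X * X)"
  unfolding singval_def using eigval_nonneg[OF pos_semidef_gram[OF X] t] by simp

text \<open>The number \<open>1 - eigval t (adj A * A)\<close> is an eigenvalue, at the reversed
  index, of the positive definite \<open>I - adj A * A\<close>.\<close>

lemma strictly_contractive_eigval_less_one:
  assumes A: "A \<in> carrier_mat n n" and sc: "strictly_contractive A" and t: "1 \<le> t" "t \<le> n"
  shows "eigval t (adj A * A) < 1"
proof -
  note P = pos_semidefD(1,2)[OF pos_semidef_gram[OF A]]
  have "pos_def (1\<^sub>m n - adj A * A)" using sc A by (simp add: strictly_contractive_def)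
  moreover have "1\<^sub>m n - adj A * A \<in> carrier_mat n n" using A by (intro carrier_matI) auto
  ultimately have "0 < eigval (n - t + 1) (1\<^sub>m n - adj A * A)" by (rule eigval_pos) (use t in auto)
  also have "\<dots> = 1 - eigval t (adj A * A)"
    using eigval_one_minus[OF P, of "n - t + 1"] t by simp
  finally show ?thesis by simp
qed

theorem theorem4p3:
  fixes n k :: nat and i :: "nat \<Rightarrow> nat" and A B F H :: "complex mat"
  assumes "1 \<le> n" and "1 \<le> k" and "k \<le> n"
    and "strict_mono_on {1..k} i" and "\<forall>t\<in>{1..k}. 1 \<le> i t \<and> i t \<le> n"
    and "A \<in> carrier_mat n n" and "B \<in> carrier_mat n n"
    and "strictly_contractive A" and "strictly_contractive B"
    and "F = 1\<^sub>m n - adj B * B"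
    and "H = adj (A - B) * inv_mat (1\<^sub>m n - A * adj A) * (A - B)"
  shows "(\<Prod>t=1..k. (singval (i t) (1\<^sub>m n - adj A * B))\<^sup>2)
    \<ge> (\<Prod>t=1..k. (1 - eigval t (adj A * A)) * (1 - eigval (n - i t + 1) (adj B * B)))
      + (\<Prod>t=1..k. (1 - eigval t (adj A * A)) * (singval (n - t + 1) (A - B))\<^sup>2
                    / (1 - eigval (n - t + 1) (adj A * A)))
      + (2 ^ k - 2) * (\<Prod>t=1..k. (1 - eigval t (adj A * A))
                    * sqrt (eigval (i t) F * eigval (n - t + 1) H))"
proof -
  note kn = assms(3) and mono = assms(4) and A = assms(6) and B = assms(7)
  have rng: "1 \<le> i t" "i t \<le> n" if "t \<in> {1..k}" for t using assms(5) that by auto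
  define C where "C = 1\<^sub>m n - adj A * B"
  define E where "E = A - B"
  define \<alpha> where "\<alpha> t = eigval t (adj A * A)" for t
  have C: "C \<in> carrier_mat n n" and E: "E \<in> carrier_mat n n" and F: "F \<in> carrier_mat n n"
    using A B unfolding C_def E_def assms(10) by (auto intro!: carrier_matI)
  have lt: "eigval t (adj A * A) < 1" if "1 \<le> t" "t \<le> n" for t
    by (rule strictly_contractive_eigval_less_one[OF A assms(8) that])
  note psdA = pos_semidef_gram[OF A] and psdB = pos_semidef_gram[OF B]
  obtain U where D: "eigen_decomp n U (\<lambda>j. eigval (Suc j) (adj A * A)) (adj A * A)"
    by (rule hermitian_spectral[OF pos_semidefD(1,2)[OF psdA]])
  obtain G where DG: "eigen_decomp n U (\<lambda>j. 1 / (1 - eigval (Suc j) (adj A * A))) G"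
    and GW: "G * (1\<^sub>m n - adj A * A) = 1\<^sub>m n" and WG: "(1\<^sub>m n - adj A * A) * G = 1\<^sub>m n"
    by (rule resolvent_exists[OF A lt D])
  have G: "G \<in> carrier_mat n n" and adjG: "adj G = G"
    by (rule eigen_decompD(5)[OF DG], rule eigen_decomp_hermitian[OF DG])
  have psdG: "pos_semidef n G"
    unfolding pos_semidef_def
  proof (intro conjI ballI G adjG)
    fix v :: "complex vec" assume v: "v \<in> carrier_vec n"
    show "0 \<le> Re ((G *\<^sub>v v) \<bullet>c v)"
      unfolding eigen_decomp_form(1)[OF DG v] Re_complex_of_real
    proof (rule sum_nonneg)
      fix j assume "j \<in> {..<n}"
      then have "eigval (Suc j) (adj A * A) < 1" using lt[of "Suc j"] by simp
      then show "0 \<le> 1 / (1 - eigval (Suc j) (adj A * A)) * (cmod ((adj U *\<^sub>v v) $ j))\<^sup>2"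
        by (intro mult_nonneg_nonneg) auto
    qed
  qed
  \<comment> \<open>\<open>1 / (1 - x)\<close> is increasing for \<open>x < 1\<close>, so the values
    of \<open>G\<close> are already in decreasing order.\<close>
  have eigG: "eigval t G = 1 / (1 - \<alpha> t)" if t: "1 \<le> t" "t \<le> n" for t
  proof -
    have "eigval t G = 1 / (1 - eigval (Suc (t - 1)) (adj A * A))"
    proof (rule eigval_eigen_decomp[OF DG _ t])
      fix i j assume ij: "i \<le> j" "j < n"
      have "eigval (Suc j) (adj A * A) \<le> eigval (Suc i) (adj A * A)"
        by (rule eigval_antimono[OF pos_semidefD(1)[OF psdA]]) (use ij in auto)
      moreover have "eigval (Suc i) (adj A * A) < 1" by (rule lt) (use ij in auto)
      ultimately show "1 / (1 - eigval (Suc j) (adj A * A)) \<le> 1 / (1 - eigval (Suc i) (adj A * A))"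
        by (intro divide_left_mono) auto
    qed
    then show ?thesis using t by (simp add: \<alpha>_def)
  qed
  define K where "K = 1\<^sub>m n + A * G * adj A"
  have K: "K \<in> carrier_mat n n" and AK: "adj A * K = G * adj A"
    and GA: "G * (adj A * A) = G - 1\<^sub>m n" and KR: "(1\<^sub>m n - A * adj A) * K = 1\<^sub>m n"
    and hua: "adj C * G * C = F + adj E * K * E"
    unfolding C_def E_def assms(10)
    by (rule K_carrier[OF A G GW WG K_def] adj_A_mult_K[OF A G GW WG K_def]
        G_mult[OF A G GW WG K_def] K_right[OF A G GW WG K_def] hua_identity[OF A G GW WG K_def B])+
  have "inv_mat (1\<^sub>m n - A * adj A) = K"
    by (rule inv_mat_eqI[OF _ K KR]) (use A in \<open>auto intro!: carrier_matI\<close>)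
  then have Hdef: "H = adj E * K * E" by (simp add: assms(11) E_def)
  \<comment> \<open>\<open>K\<close> is the identity plus a positive semidefinite congruence of
    \<open>G\<close>.\<close>
  have Kform: "Re (w \<bullet>c w) \<le> Re ((K *\<^sub>v w) \<bullet>c w)" if w: "w \<in> carrier_vec n" for w
  proof -
    let ?L = "A * G * adj A"
    have psdL: "pos_semidef n ?L"
      using pos_semidef_congruence[OF psdG adj_carrier[OF A]] by simp
    have "K *\<^sub>v w = w + ?L *\<^sub>v w"
      unfolding K_def using w pos_semidefD(1)[OF psdL] by (simp add: add_mult_distrib_mat_vec[of _ n n])
    moreover have "(w + ?L *\<^sub>v w) \<bullet>c w = w \<bullet>c w + (?L *\<^sub>v w) \<bullet>c w"
      using w mult_mat_vec_carrier[OF pos_semidefD(1)[OF psdL] w]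
      by (intro add_scalar_prod_distrib[of _ n]) auto
    ultimately show ?thesis using pos_semidefD(3)[OF psdL w] by simp
  qed
  have adjK: "adj K = K"
    unfolding K_def using A G by (simp add: adj_add adj_mult adjG mult_assoc_dim)
  have psdK: "pos_semidef n K"
    unfolding pos_semidef_def
  proof (intro conjI ballI K adjK)
    fix v :: "complex vec" assume v: "v \<in> carrier_vec n"
    have "0 \<le> Re (v \<bullet>c v)" using pos_semidefD(3)[OF pos_semidef_one v] v by simp
    then show "0 \<le> Re ((K *\<^sub>v v) \<bullet>c v)" using Kform[OF v] by simp
  qed
  have psdH: "pos_semidef n H" unfolding Hdef by (rule pos_semidef_congruence[OF psdK E])
  have pdF: "pos_def F" using assms(9) B by (simp add: strictly_contractive_def assms(10))
  note adjF = pos_defD(1)[OF pdF F]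
  define M where "M = adj C * C"
  have psdM: "pos_semidef n M" unfolding M_def by (rule pos_semidef_gram[OF C])
  obtain V where V: "V \<in> carrier_mat n k" and VV: "adj V * V = 1\<^sub>m k"
    and VM: "\<And>t. t \<in> {1..k} \<Longrightarrow> eigval t (adj V * M * V) \<le> eigval (i t) M"
    and VF: "\<And>t. t \<in> {1..k} \<Longrightarrow> eigval (i t) F \<le> eigval t (adj V * F * V)"
    using simultaneous_compression[OF pos_semidefD(1,2)[OF psdM] F adjF mono assms(5)] by blast
  have Vinj: "V *\<^sub>v v \<noteq> 0\<^sub>v n" if "v \<in> carrier_vec k" "v \<noteq> 0\<^sub>v k" for v
    by (rule nonzero_of_cscalar_prod_eq[OF cscalar_prod_isometry[OF V VV that(1)] that])
  define P where "P = adj V * F * V"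
  define Q where "Q = adj V * H * V"
  have P: "P \<in> carrier_mat k k" and adjP: "adj P = P"
    unfolding P_def by (rule adj_congruence[OF F adjF V])+
  have pdP: "pos_def P"
  proof (rule pos_defI[OF P adjP])
    fix v :: "complex vec" assume v: "v \<in> carrier_vec k" "v \<noteq> 0\<^sub>v k"
    show "0 < Re ((P *\<^sub>v v) \<bullet>c v)"
      unfolding P_def congruence_form[OF F V v(1)]
      by (rule pos_defD(2)[OF pdF F mult_mat_vec_carrier[OF V v(1)] Vinj[OF v]])
  qed
  have psdQ: "pos_semidef k Q" unfolding Q_def by (rule pos_semidef_congruence[OF psdH V])
  define Y where "Y = C * V"
  have Y: "Y \<in> carrier_mat n k" using C V by (simp add: Y_def)
  have YY: "adj Y * Y = adj V * M * V"
    unfolding Y_def M_def using C V by (simp add: adj_mult mult_assoc_dim)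
  \<comment> \<open>Hua's identity compressed by \<open>V\<close>; this carries the inequality into
    dimension \<open>k\<close>.\<close>
  have YGY: "adj Y * G * Y = P + Q"
  proof -
    have "adj Y * G * Y = adj V * (adj C * G * C) * V"
      unfolding Y_def using C V G by (simp add: adj_mult mult_assoc_dim)
    also have "\<dots> = P + Q"
      unfolding hua P_def Q_def Hdef using F E K V by (simp add: mat_distribs_dim)
    finally show ?thesis .
  qed
  have pdY: "pos_def (adj Y * Y)"
  proof (rule pos_defI[OF pos_semidefD(1,2)[OF pos_semidef_gram[OF Y]]])
    fix v :: "complex vec" assume v: "v \<in> carrier_vec k" "v \<noteq> 0\<^sub>v k"
    have Yv: "Y *\<^sub>v v \<in> carrier_vec n" by (rule mult_mat_vec_carrier[OF Y v(1)])
    \<comment> \<open>Injectivity of \<open>Y\<close> comes from the compressed identity: a kernel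
      vector would make the form of \<open>P + Q\<close> vanish, while \<open>P\<close> is positive
      definite.\<close>
    have "Y *\<^sub>v v \<noteq> 0\<^sub>v n"
    proof
      assume 0: "Y *\<^sub>v v = 0\<^sub>v n"
      have "(adj Y * G * Y *\<^sub>v v) \<bullet>c v = 0"
        unfolding congruence_form[OF G Y v(1)] 0 using G by simp
      moreover have "(adj Y * G * Y *\<^sub>v v) \<bullet>c v = (P *\<^sub>v v) \<bullet>c v + (Q *\<^sub>v v) \<bullet>c v"
      proof -
        note Qc = pos_semidefD(1)[OF psdQ]
        have "(P + Q) *\<^sub>v v = P *\<^sub>v v + Q *\<^sub>v v"
          by (rule add_mult_distrib_mat_vec[OF P Qc v(1)])
        then show ?thesis
          unfolding YGY using mult_mat_vec_carrier[OF P v(1)] mult_mat_vec_carrier[OF Qc v(1)] v(1)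
          by (simp add: add_scalar_prod_distrib[of _ k])
      qed
      ultimately have "Re ((P *\<^sub>v v) \<bullet>c v) + Re ((Q *\<^sub>v v) \<bullet>c v) = 0"
        by (metis plus_complex.sel(1) zero_complex.sel(1))
      then show False using pos_defD(2)[OF pdP P v] pos_semidefD(3)[OF psdQ v(1)] by simp
    qed
    from cscalar_prod_self_pos[OF Yv this] show "0 < Re ((adj Y * Y *\<^sub>v v) \<bullet>c v)"
      unfolding gram_form[OF Y v(1)] .
  qed

  \<comment> \<open>\<open>p\<close> is the reciprocal of the product of the \<open>k\<close>
    largest eigenvalues of \<open>G\<close>, and the common factor of all three terms of the
    bound.\<close>
  define p where "p = (\<Prod>t=1..k. 1 - \<alpha> t)"
  have \<alpha>: "\<alpha> t < 1" if "1 \<le> t" "t \<le> n" for t unfolding \<alpha>_def by (rule lt[OF that])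
  have p: "0 < p" unfolding p_def by (rule prod_pos) (use \<alpha> kn in auto)
  have pG: "p * (\<Prod>t=1..k. eigval t G) = 1"
  proof -
    have "p * (\<Prod>t=1..k. eigval t G) = (\<Prod>t=1..k. (1 - \<alpha> t) * eigval t G)"
      by (simp only: p_def prod.distrib)
    also have "\<dots> = (\<Prod>t=1..k. 1)"
    proof (rule prod.cong[OF refl])
      fix t assume "t \<in> {1..k}"
      then have t: "1 \<le> t" "t \<le> n" using kn by auto
      show "(1 - \<alpha> t) * eigval t G = 1" using \<alpha>[OF t] by (simp add: eigG[OF t])
    qed
    finally show ?thesis by simp
  qed

  have "Re (det (adj Y * Y)) = (\<Prod>t=1..k. eigval t (adj V * M * V))"
    unfolding YY by (rule Re_det_hermitian[OF pos_semidefD(1,2)[OF pos_semidef_congruence[OF psdM V]]])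
  also have "\<dots> \<le> (\<Prod>t=1..k. eigval (i t) M)"
    using VM eigval_nonneg[OF pos_semidef_congruence[OF psdM V]] by (intro prod_mono) auto
  also have "\<dots> = (\<Prod>t=1..k. (singval (i t) C)\<^sup>2)"
    using rng by (intro prod.cong) (auto simp: M_def singval_sq[OF C])
  finally have step1: "Re (det (adj Y * Y)) \<le> (\<Prod>t=1..k. (singval (i t) C)\<^sup>2)" .
  have "p * Re (det (P + Q)) \<le> p * (Re (det (adj Y * Y)) * (\<Prod>t=1..k. eigval t G))"
    unfolding YGY[symmetric] using p by (intro mult_left_mono det_congruence_le[OF psdG Y pdY kn]) auto
  also have "\<dots> = (p * (\<Prod>t=1..k. eigval t G)) * Re (det (adj Y * Y))" by (simp only: mult_ac)
  also have "\<dots> \<le> (\<Prod>t=1..k. (singval (i t) C)\<^sup>2)" unfolding pG using step1 by simp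
  finally have step2: "p * Re (det (P + Q)) \<le> (\<Prod>t=1..k. (singval (i t) C)\<^sup>2)" .

  \<comment> \<open>\<open>det Q\<close> has two lower bounds, \<open>b\<close> and
    \<open>c\<close>: \<open>c\<close> serves in the linear term and \<open>b\<close> under the
    square root.\<close>
  define a where "a = (\<Prod>t=1..k. eigval (i t) F)"
  define b where "b = (\<Prod>t=1..k. eigval (n - t + 1) H)"
  define c where "c = (\<Prod>t=1..k. (singval (n - t + 1) E)\<^sup>2 / (1 - \<alpha> (n - t + 1)))"
  have a0: "0 \<le> a" unfolding a_def by (rule prod_nonneg) (use eigval_pos[OF pdF F] rng in \<open>auto intro: less_imp_le\<close>)
  have b0: "0 \<le> b" unfolding b_def by (rule prod_nonneg) (use eigval_nonneg[OF psdH] kn in auto)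
  have a: "a \<le> Re (det P)"
    unfolding Re_det_hermitian[OF P adjP] unfolding a_def P_def
    using VF eigval_pos[OF pdF F] rng by (intro prod_mono) (auto intro: less_imp_le)
  have b: "b \<le> Re (det Q)"
    unfolding b_def prod_reverse_index[OF kn, of "\<lambda>j. eigval j H"] Q_def by (rule det_compression_ge[OF psdH V VV kn])
  have c: "c \<le> Re (det Q)"
  proof -
    have psdE: "pos_semidef n (adj E * E)" by (rule pos_semidef_gram[OF E])
    have EV: "E * V \<in> carrier_mat n k" using E V by simp
    have "c = (\<Prod>t=1..k. (singval (n - k + t) E)\<^sup>2 / (1 - \<alpha> (n - k + t)))"
      unfolding c_def by (rule prod_reverse_index[OF kn, of "\<lambda>j. (singval j E)\<^sup>2 / (1 - \<alpha> j)"])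
    \<comment> \<open>The lower bound for eigenvalues of \<open>K\<close> replaces
      \<open>1 / (1 - \<alpha>)\<close>, so that \<open>E\<close> and \<open>K\<close> can be
      separated.\<close>
    also have "\<dots> \<le> (\<Prod>t=1..k. eigval (n - k + t) (adj E * E) * eigval (n - k + t) K)"
    proof (rule prod_mono)
      fix t assume "t \<in> {1..k}"
      then have t: "1 \<le> n - k + t" "n - k + t \<le> n" using kn by auto
      have "1 / (1 - \<alpha> (n - k + t)) \<le> eigval (n - k + t) K"
        unfolding \<alpha>_def by (rule eigval_dual_resolvent_ge[OF A lt D DG psdK AK GA Kform t])
      from mult_left_mono[OF this eigval_nonneg[OF psdE t]]
      show "0 \<le> (singval (n - k + t) E)\<^sup>2 / (1 - \<alpha> (n - k + t)) \<and>
          (singval (n - k + t) E)\<^sup>2 / (1 - \<alpha> (n - k + t))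
            \<le> eigval (n - k + t) (adj E * E) * eigval (n - k + t) K"
        unfolding singval_sq[OF E t] using eigval_nonneg[OF psdE t] \<alpha>[OF t] by simp
    qed
    also have "\<dots> = (\<Prod>t=1..k. eigval (n - k + t) (adj E * E)) * (\<Prod>t=1..k. eigval (n - k + t) K)"
      by (rule prod.distrib)
    \<comment> \<open>Two compression bounds in succession: the smallest eigenvalues of
      \<open>adj E * E\<close> are bounded by the Gram determinant of \<open>E * V\<close>, and then
      those of \<open>K\<close> are absorbed into \<open>det Q\<close>.\<close>
    also have "\<dots> \<le> Re (det (adj V * (adj E * E) * V)) * (\<Prod>t=1..k. eigval (n - k + t) K)"
      by (intro mult_right_mono det_compression_ge[OF psdE V VV kn] prod_nonneg)
        (use eigval_nonneg[OF psdK] kn in auto)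
    also have "adj V * (adj E * E) * V = adj (E * V) * (E * V)"
      using E V by (simp add: adj_mult mult_assoc_dim)
    also have "Re (det \<dots>) * (\<Prod>t=1..k. eigval (n - k + t) K) \<le> Re (det (adj (E * V) * K * (E * V)))"
      by (rule det_congruence_ge[OF psdK EV kn])
    also have "adj (E * V) * K * (E * V) = Q"
      unfolding Q_def Hdef using E V K by (simp add: adj_mult mult_assoc_dim)
    finally show ?thesis .
  qed
  \<comment> \<open>Here \<open>1 \<le> k\<close> enters: the coefficient of the mixed term must be
    nonnegative for its lower bound to survive multiplication.\<close>
  have two: "(0::real) \<le> 2 ^ k - 2" using power_increasing[of 1 k "2::real"] assms(2) by simp
  have "sqrt (a * b) \<le> sqrt (Re (det P) * Re (det Q))"
    using a b a0 b0 by (intro real_sqrt_le_mono mult_mono) auto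
  from mult_left_mono[OF this two]
  have "a + c + (2 ^ k - 2) * sqrt (a * b) \<le> Re (det (P + Q))"
    using a c det_add_ge[OF pdP P psdQ] by linarith
  from mult_left_mono[OF this less_imp_le[OF p]] step2
  have final: "p * a + p * c + (2 ^ k - 2) * (p * sqrt (a * b)) \<le> (\<Prod>t=1..k. (singval (i t) C)\<^sup>2)"
    by (simp add: algebra_simps)
  \<comment> \<open>The factor with index \<open>n - i t + 1\<close> for \<open>adj B * B\<close> is
    the eigenvalue of \<open>F = I - adj B * B\<close> with index \<open>i t\<close>.\<close>
  have "(\<Prod>t=1..k. (1 - \<alpha> t) * (1 - eigval (n - i t + 1) (adj B * B))) = p * a"
    unfolding p_def a_def prod.distrib[symmetric]
    using rng eigval_one_minus[OF pos_semidefD(1,2)[OF psdB]] by (intro prod.cong) (auto simp: assms(10))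
  moreover have "(\<Prod>t=1..k. (1 - \<alpha> t) * (singval (n - t + 1) E)\<^sup>2 / (1 - \<alpha> (n - t + 1))) = p * c"
    unfolding p_def c_def prod.distrib[symmetric] by simp
  moreover have "(\<Prod>t=1..k. (1 - \<alpha> t) * sqrt (eigval (i t) F * eigval (n - t + 1) H)) = p * sqrt (a * b)"
    unfolding p_def a_def b_def prod.distrib real_sqrt_mult
    by (simp only: sqrt_prod)
  ultimately show ?thesis using final unfolding \<alpha>_def C_def E_def by simp
qed

end
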